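(* Let $F$ be either a non-Archimedean local field of characteristic zero or $F=\mathbb{R}$, let $\psi:F\to\mathbb{C}^\times$ be a nontrivial additive character, and let $V\cong\mathbb{G}_a^{2n}$ be equipped with a split nondegenerate quadratic form $\mathcal Q$; if $F$ is non-Archimedean assume $2n\ge 6$. Let $X\subset V$ be the zero locus of $\mathcal Q$, with its action of $\mathbb{G}_m\times\mathrm{GO}_{2n}$ ($\mathbb{G}_m$ acting by scaling), and let $\omega:X\to V$ be the inclusion. Then the modulation group $\Psi_\omega\{F\}$ is the image of $\mathrm{GO}_{2n+2}(F)$ under the minimal representation $\widetilde\tau$ on $L^2(X^{\mathrm{sm}}(F))$.
   Context: Write row vectors and right actions. Let $J$ be the symmetric Gram matrix of $\mathcal Q$, $\langle v,v'\rangle=vJv'^t$, $\mathcal Q(v)=\tfrac12\langle v,v\rangle$, $d=2n=\dim V$. Let $V_+=\mathbb{G}_a\oplus V\oplus\mathbb{G}_a$ with Gram matrix $\begin{pmatrix}&&1\\&J&\\1&&\end{pmatrix}$ (also split, of dimension $2n+2$). $\mathrm{GO}_{2n}$, $\mathrm{GO}_{2n+2}$ are the orthogonal similitude groups of $V$, $V_+$, $\mathrm{O}_{2n+2}$ is the orthogonal group of $V_+$, and $\nu$ denotes the similitude norm. For $a\in F^\times$, $g\in\mathrm{GO}_{2n}(F)$, $v\in V(F)$ put $$m(a,g)=\begin{pmatrix}a\nu(g)&&\\&g&\\&&a^{-1}\end{pmatrix},\quad n(v)=\begin{pmatrix}1&v&-\mathcal Q(v)\\&I&-Jv^t\\&&1\end{pmatrix},\quad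 w_0=\begin{pmatrix}&&1\\&I&\\1&&\end{pmatrix}.$$ $X^{\mathrm{sm}}=X-\{0\}$. Let $L^2(X^{\mathrm{sm}}(F))$ be taken with respect to the measure $|\omega_X|$, where $\omega_X$ is the top-degree form with $dv_1\wedge\cdots\wedge dv_{d}=d\mathcal Q\wedge\omega_X$; multiplying by $|\omega_X|^{1/2}$ identifies it with the space of $L^2$ half-densities. Minimal representation. Define operators $$\widetilde\tau(n(v)m(a,g))f(c)=\psi(\langle v,c\rangle)\,|a|^{(d-2)/2}|\nu(g)|^{(d-2)/4}f(acg).$$ These give a unitary representation of the parabolic subgroup $\{n(v)m(a,g)\}$ of $\mathrm{GO}_{2n+2}(F)$. The restriction to the subgroup with $g\in \mathrm{O}_{2n}(F)$ extends to a unitary representation $\tau$ of $\mathrm{O}_{2n+2}(F)$ on $L^2(X^{\mathrm{sm}}(F))$, the minimal representation (in the model of Gurevich–Kazhdan for $F$ non-Archimedean and Kobayashi–Mano for $F=\mathbb R$), and $\widetilde\tau(m(a,g)h):=\widetilde\tau(m(a,g))\tau(h)$ for $h\in\mathrm{O}_{2n+2}(F)$ is a well-defined unitary representation of $\mathrm{GO}_{2n+2}(F)$, also called the minimal representation. Modulation group. The Fourier transform is $\mathcal F_X:=\widetilde\tau(w_0)$. The modulation group $\Psi_\omega\{F\}$ is the subgroup of the group of unitary operators of $L^2(X^{\mathrm{sm}}(F))$ generated by $\mathcal F_X$ and all operators $f(c)\mapsto\psi(\langle v,c\rangle)|a|^{(d-2)/2}|\nu(h)|^{(d-2)/4}f(ach)$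 for $v\in V(F)$, $a\in F^\times$, $h\in\mathrm{GO}_{2n}(F)$. *)

theory Defs
  imports "HOL-Analysis.Analysis" "HOL-Algebra.Bij" "HOL-Algebra.Generated_Groups"
begin

section \<open>Local fields\<close>

text \<open>A field of characteristic zero whose topology is given by an absolute value, the latter
  being \<open>x \<mapsto> dist x 0\<close>.\<close>

class valued_field_0 = field_char_0 + metric_space +
  assumes dist_eq_dist_diff_0: "dist x y = dist (x - y) 0"
    and dist_mult_0: "dist (x * y) 0 = dist x 0 * dist y 0"

instance real :: valued_field_0
  by standard (simp_all add: dist_real_def abs_mult)

definition absval :: "'f::valued_field_0 \<Rightarrow> real"
  where "absval x = dist x 0"

definition residue_field :: "'f::valued_field_0 itself \<Rightarrow> 'f set set"
  where "residue_field _ =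
    {x. absval x \<le> 1} // {(x, y). absval x \<le> 1 \<and> absval y \<le> 1 \<and> absval (x - y) < 1}"

text \<open>The last conjunct normalizes the absolute value: a uniformizer \<open>\<pi>\<close> has absolute value
  \<open>1/q\<close>, where \<open>q\<close> is the order of the residue field.  This is the normalization for which
  multiplication by \<open>a\<close> scales additive Haar measure by \<open>absval a\<close>.\<close>

definition nonarchimedean_local_field :: "'f::valued_field_0 itself \<Rightarrow> bool"
  where "nonarchimedean_local_field F \<longleftrightarrow>
    (\<forall>x y::'f. absval (x + y) \<le> max (absval x) (absval y)) \<and>
    complete (UNIV :: 'f set) \<and>
    finite (residue_field F) \<and>
    (\<exists>\<pi>::'f. 0 < absval \<pi> \<and> absval \<pi> < 1 \<and>
       (\<forall>x::'f. x \<noteq> 0 \<longrightarrow> (\<exists>k::int. absval x = absval \<pi> powi k)) \<and>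
       absval \<pi> = 1 / real (card (residue_field F)))"

text \<open>\<open>F = \<real>\<close>, up to an isomorphism of valued fields.\<close>

definition is_real_field :: "'f::valued_field_0 itself \<Rightarrow> bool"
  where "is_real_field _ \<longleftrightarrow>
    (\<exists>\<phi>::'f \<Rightarrow> real. bij \<phi> \<and> (\<forall>x y. \<phi> (x + y) = \<phi> x + \<phi> y) \<and>
       (\<forall>x y. \<phi> (x * y) = \<phi> x * \<phi> y) \<and> (\<forall>x. \<bar>\<phi> x\<bar> = absval x))"

definition nontrivial_additive_character :: "('f::valued_field_0 \<Rightarrow> complex) \<Rightarrow> bool"
  where "nontrivial_additive_character \<psi> \<longleftrightarrow>
    continuous_on UNIV \<psi> \<and> (\<forall>x y. \<psi> (x + y) = \<psi> x * \<psi> y) \<and>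
    (\<forall>x. norm (\<psi> x) = 1) \<and> (\<exists>x. \<psi> x \<noteq> 1)"

definition haar_measure :: "'f::valued_field_0 measure \<Rightarrow> bool"
  where "haar_measure \<mu> \<longleftrightarrow>
    sets \<mu> = sets borel \<and>
    (\<forall>x. \<forall>A\<in>sets borel. emeasure \<mu> ((+) x ` A) = emeasure \<mu> A) \<and>
    (\<forall>K. compact K \<longrightarrow> emeasure \<mu> K < \<infinity>) \<and>
    emeasure \<mu> UNIV \<noteq> 0"


section \<open>Quadratic spaces and orthogonal groups\<close>

text \<open>Vectors are row vectors and matrices act from the right, \<open>v \<mapsto> v v* g\<close>.\<close>

definition bform :: "'f::field^'i^'i \<Rightarrow> 'f^'i \<Rightarrow> 'f^'i \<Rightarrow> 'f"
  where "bform J v w = (\<Sum>i\<in>UNIV. (v v* J) $ i * w $ i)"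

definition qform :: "'f::field^'i^'i \<Rightarrow> 'f^'i \<Rightarrow> 'f"
  where "qform J v = bform J v v / 2"

text \<open>Nondegenerate and split of dimension \<open>2n\<close>: there is a totally isotropic subspace of
  dimension \<open>n\<close>.\<close>

definition split_quadratic_space :: "nat \<Rightarrow> 'f::field^'i^'i \<Rightarrow> bool"
  where "split_quadratic_space n J \<longleftrightarrow>
    CARD('i) = 2 * n \<and> transpose J = J \<and> invertible J \<and>
    (\<exists>W. vec.subspace W \<and> vec.dim W = n \<and> (\<forall>w\<in>W. qform J w = 0))"

definition orth_group :: "'f::field^'i^'i \<Rightarrow> ('f^'i^'i) monoid"
  where "orth_group J =
    \<lparr>carrier = {g. invertible g \<and> g ** J ** transpose g = J}, mult = (**), one = mat 1\<rparr>"

definition orth_sim_group :: "'f::field^'i^'i \<Rightarrow> ('f^'i^'i) monoid"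
  where "orth_sim_group J =
    \<lparr>carrier = {g. invertible g \<and> (\<exists>c. c \<noteq> 0 \<and> g ** J ** transpose g = (\<chi> i j. c * J $ i $ j))},
     mult = (**), one = mat 1\<rparr>"

definition sim_norm :: "'f::field^'i^'i \<Rightarrow> 'f^'i^'i \<Rightarrow> 'f"
  where "sim_norm J g = (THE c. g ** J ** transpose g = (\<chi> i j. c * J $ i $ j))"

text \<open>Index type of the coordinates of \<open>V\<^sub>+ = F \<oplus> V \<oplus> F\<close>.\<close>

datatype 'd plus_index = Fst | Mid 'd | Lst

instance plus_index :: (finite) finite
proof
  have "x \<in> {Fst, Lst} \<union> range Mid" for x :: "'a plus_index"
    by (cases x) auto
  then show "finite (UNIV :: 'a plus_index set)"
    by (intro finite_subset[of UNIV "{Fst, Lst} \<union> range Mid"]) auto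
qed

definition gram_plus :: "'f::field^'d^'d \<Rightarrow> 'f^('d plus_index)^('d plus_index)"
  where "gram_plus J = (\<chi> i j. case (i, j) of
      (Fst, Lst) \<Rightarrow> 1 | (Mid k, Mid l) \<Rightarrow> J $ k $ l | (Lst, Fst) \<Rightarrow> 1 | _ \<Rightarrow> 0)"

definition m_mat :: "'f::field^'d^'d \<Rightarrow> 'f \<Rightarrow> 'f^'d^'d \<Rightarrow> 'f^('d plus_index)^('d plus_index)"
  where "m_mat J a g = (\<chi> i j. case (i, j) of
      (Fst, Fst) \<Rightarrow> a * sim_norm J g | (Mid k, Mid l) \<Rightarrow> g $ k $ l | (Lst, Lst) \<Rightarrow> inverse a
    | _ \<Rightarrow> 0)"

definition n_mat :: "'f::field^'d^'d \<Rightarrow> 'f^'d \<Rightarrow> 'f^('d plus_index)^('d plus_index)"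
  where "n_mat J v = (\<chi> i j. case (i, j) of
      (Fst, Fst) \<Rightarrow> 1 | (Fst, Mid l) \<Rightarrow> v $ l | (Fst, Lst) \<Rightarrow> - qform J v
    | (Mid k, Mid l) \<Rightarrow> (if k = l then 1 else 0) | (Mid k, Lst) \<Rightarrow> - (J *v v) $ k
    | (Lst, Lst) \<Rightarrow> 1 | _ \<Rightarrow> 0)"

definition w0_mat :: "'f::field^('d::finite plus_index)^('d plus_index)"
  where "w0_mat = (\<chi> i j. case (i, j) of
      (Fst, Lst) \<Rightarrow> 1 | (Mid k, Mid l) \<Rightarrow> (if k = l then 1 else 0) | (Lst, Fst) \<Rightarrow> 1 | _ \<Rightarrow> 0)"


section \<open>The punctured cone and its measure\<close>

definition cone_sm :: "'f::field^'d^'d \<Rightarrow> ('f^'d) set"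
  where "cone_sm J = {v. qform J v = 0} - {0}"

text \<open>\<open>M\<close> is the measure \<open>|\<omega>\<^sub>X|\<close> on \<open>X\<^sup>s\<^sup>m(F)\<close>, where \<open>dv\<^sub>1 \<and> \<dots> \<and> dv\<^sub>d = dQ \<and> \<omega>\<^sub>X\<close>
  and where \<open>F\<close> carries the Haar measure \<open>\<mu>\<close>.
  The \<open>i\<close>-th partial derivative of \<open>Q\<close> at \<open>c\<close> is \<open>(J *v c) $ i\<close>.  Where it does not vanish, the
  remaining coordinates \<open>v\<^sub>j\<close>, \<open>j \<noteq> i\<close>, are local coordinates on \<open>X\<^sup>s\<^sup>m\<close>, in which
  \<open>\<omega>\<^sub>X\<close> is, up to sign, \<open>(\<partial>\<^sub>iQ)\<inverse>\<close> times the wedge product of the \<open>dv\<^sub>j\<close>.  The projection to these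
  coordinates is only locally injective, so the measure of a subset of the chart is the integral of
  a sum over the fibres of the projection, each having at most two points.  As \<open>J\<close> is invertible,
  these charts cover \<open>X\<^sup>s\<^sup>m\<close> and \<open>M\<close> is unique.\<close>

definition omega_X_measure ::
    "'f::valued_field_0^'d^'d \<Rightarrow> 'f measure \<Rightarrow> ('f^'d) measure \<Rightarrow> bool"
  where "omega_X_measure J \<mu> M \<longleftrightarrow>
    space M = cone_sm J \<and> sets M = sets (restrict_space borel (cone_sm J)) \<and>
    (\<forall>i. \<forall>A\<in>sets M. (\<forall>c\<in>A. (J *v c) $ i \<noteq> 0) \<longrightarrow>
       emeasure M A =
         (\<integral>\<^sup>+ y. (\<Sum>c\<in>{c\<in>A. restrict (($) c) (UNIV - {i}) = y}.
              ennreal (1 / absval ((J *v c) $ i)))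
           \<partial>Pi\<^sub>M (UNIV - {i}) (\<lambda>_. \<mu>)))"


section \<open>\<open>L\<^sup>2\<close> spaces and unitary representations\<close>

definition square_integrable :: "'a measure \<Rightarrow> ('a \<Rightarrow> complex) \<Rightarrow> bool"
  where "square_integrable M f \<longleftrightarrow>
    f \<in> borel_measurable M \<and> integrable M (\<lambda>x. (norm (f x))\<^sup>2)"

definition L2_class :: "'a measure \<Rightarrow> ('a \<Rightarrow> complex) \<Rightarrow> ('a \<Rightarrow> complex) set"
  where "L2_class M f = {g. square_integrable M g \<and> (AE x in M. g x = f x)}"

definition L2 :: "'a measure \<Rightarrow> ('a \<Rightarrow> complex) set set"
  where "L2 M = L2_class M ` {f. square_integrable M f}"

definition L2_add ::
    "'a measure \<Rightarrow> ('a \<Rightarrow> complex) set \<Rightarrow> ('a \<Rightarrow> complex) set \<Rightarrow> ('a \<Rightarrow> complex) set"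
  where "L2_add M A B = (\<Union>f\<in>A. \<Union>g\<in>B. L2_class M (\<lambda>x. f x + g x))"

definition L2_scale :: "'a measure \<Rightarrow> complex \<Rightarrow> ('a \<Rightarrow> complex) set \<Rightarrow> ('a \<Rightarrow> complex) set"
  where "L2_scale M z A = (\<Union>f\<in>A. L2_class M (\<lambda>x. z * f x))"

definition L2_inner :: "'a measure \<Rightarrow> ('a \<Rightarrow> complex) set \<Rightarrow> ('a \<Rightarrow> complex) set \<Rightarrow> complex"
  where "L2_inner M A B = (THE z. \<exists>f\<in>A. \<exists>g\<in>B. z = (\<integral>x. f x * cnj (g x) \<partial>M))"

definition L2_dist :: "'a measure \<Rightarrow> ('a \<Rightarrow> complex) set \<Rightarrow> ('a \<Rightarrow> complex) set \<Rightarrow> real"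
  where "L2_dist M A B =
    (let D = L2_add M A (L2_scale M (-1) B) in sqrt (Re (L2_inner M D D)))"

text \<open>Operators are extensional functions on the set \<open>L2 M\<close>, as in \<^const>\<open>BijGroup\<close>.\<close>

definition unitary_group ::
    "'a measure \<Rightarrow> (('a \<Rightarrow> complex) set \<Rightarrow> ('a \<Rightarrow> complex) set) monoid"
  where "unitary_group M = (BijGroup (L2 M))\<lparr>carrier := {U \<in> Bij (L2 M).
      (\<forall>A\<in>L2 M. \<forall>B\<in>L2 M. U (L2_add M A B) = L2_add M (U A) (U B)) \<and>
      (\<forall>z. \<forall>A\<in>L2 M. U (L2_scale M z A) = L2_scale M z (U A)) \<and>
      (\<forall>A\<in>L2 M. \<forall>B\<in>L2 M. L2_inner M (U A) (U B) = L2_inner M A B)}\<rparr>"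

text \<open>Unitary representations are required to be strongly continuous.\<close>

definition unitary_rep ::
    "('g::topological_space) monoid \<Rightarrow> 'a measure \<Rightarrow>
      ('g \<Rightarrow> ('a \<Rightarrow> complex) set \<Rightarrow> ('a \<Rightarrow> complex) set) \<Rightarrow> bool"
  where "unitary_rep G M T \<longleftrightarrow>
    T \<in> hom G (unitary_group M) \<and>
    (\<forall>A\<in>L2 M. \<forall>g\<in>carrier G.
       ((\<lambda>h. L2_dist M (T h A) (T g A)) \<longlongrightarrow> 0) (at g within carrier G))"


section \<open>The minimal representation and the modulation group\<close>

text \<open>The operator \<open>f(c) \<mapsto> \<psi>(\<langle>v,c\<rangle>) |a|\<^bsup>(d-2)/2\<^esup> |\<nu>(g)|\<^bsup>(d-2)/4\<^esup> f(acg)\<close>.\<close>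

definition parabolic_op ::
    "('f::valued_field_0 \<Rightarrow> complex) \<Rightarrow> 'f^'d^'d \<Rightarrow> ('f^'d) measure \<Rightarrow> 'f^'d \<Rightarrow> 'f \<Rightarrow> 'f^'d^'d \<Rightarrow>
      ('f^'d \<Rightarrow> complex) set \<Rightarrow> ('f^'d \<Rightarrow> complex) set"
  where "parabolic_op \<psi> J M v a g = (\<lambda>A\<in>L2 M. \<Union>f\<in>A. L2_class M (\<lambda>c.
      \<psi> (bform J v c)
      * of_real (absval a powr ((real CARD('d) - 2) / 2))
      * of_real (absval (sim_norm J g) powr ((real CARD('d) - 2) / 4))
      * f (a *s (c v* g))))"

text \<open>\<open>\<tau>\<close> is a unitary representation of \<open>O(V\<^sub>+)\<close> extending the given representation of the
  parabolic subgroup.\<close>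

definition minimal_rep_orth ::
    "('f::valued_field_0 \<Rightarrow> complex) \<Rightarrow> 'f^'d^'d \<Rightarrow> ('f^'d) measure \<Rightarrow>
      ('f^('d plus_index)^('d plus_index) \<Rightarrow>
        ('f^'d \<Rightarrow> complex) set \<Rightarrow> ('f^'d \<Rightarrow> complex) set) \<Rightarrow> bool"
  where "minimal_rep_orth \<psi> J M \<tau> \<longleftrightarrow>
    unitary_rep (orth_group (gram_plus J)) M \<tau> \<and>
    (\<forall>v a g. a \<noteq> 0 \<longrightarrow> g \<in> carrier (orth_group J) \<longrightarrow>
       \<tau> (n_mat J v ** m_mat J a g) = parabolic_op \<psi> J M v a g)"

text \<open>\<open>T\<close> is the extension of \<open>\<tau>\<close> to a unitary representation of \<open>GO(V\<^sub>+)\<close>.  It is determined by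
  \<open>\<tau>\<close>, since every element of \<open>GO(V\<^sub>+)\<close> is of the form \<open>m(a,g)h\<close>.\<close>

definition minimal_rep_sim ::
    "('f::valued_field_0 \<Rightarrow> complex) \<Rightarrow> 'f^'d^'d \<Rightarrow> ('f^'d) measure \<Rightarrow>
      ('f^('d plus_index)^('d plus_index) \<Rightarrow>
        ('f^'d \<Rightarrow> complex) set \<Rightarrow> ('f^'d \<Rightarrow> complex) set) \<Rightarrow>
      ('f^('d plus_index)^('d plus_index) \<Rightarrow>
        ('f^'d \<Rightarrow> complex) set \<Rightarrow> ('f^'d \<Rightarrow> complex) set) \<Rightarrow> bool"
  where "minimal_rep_sim \<psi> J M \<tau> T \<longleftrightarrow>
    unitary_rep (orth_sim_group (gram_plus J)) M T \<and>
    (\<forall>a g h. a \<noteq> 0 \<longrightarrow> g \<in> carrier (orth_sim_group J) \<longrightarrow>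
       h \<in> carrier (orth_group (gram_plus J)) \<longrightarrow>
       T (m_mat J a g ** h) = parabolic_op \<psi> J M 0 a g \<otimes>\<^bsub>unitary_group M\<^esub> \<tau> h)"

definition modulation_group ::
    "('f::valued_field_0 \<Rightarrow> complex) \<Rightarrow> 'f^'d^'d \<Rightarrow> ('f^'d) measure \<Rightarrow>
      ('f^('d plus_index)^('d plus_index) \<Rightarrow>
        ('f^'d \<Rightarrow> complex) set \<Rightarrow> ('f^'d \<Rightarrow> complex) set) \<Rightarrow>
      (('f^'d \<Rightarrow> complex) set \<Rightarrow> ('f^'d \<Rightarrow> complex) set) set"
  where "modulation_group \<psi> J M T =
    generate (unitary_group M)
      (insert (T w0_mat)
        {parabolic_op \<psi> J M v a g | v a g. a \<noteq> 0 \<and> g \<in> carrier (orth_sim_group J)})"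

end

(*
  GO(V_+) is generated by w_0 and the elements n(v) m(a,g): these generators move any nonzero
  isotropic vector to the last basis vector, and a similitude fixing that vector is of the form
  m(1,g) n(v).  A representation maps the group generated by a set to the group generated by its
  image, and it sends n(v) m(a,g) to the operator attached to (v,a,g).

  The last point needs an argument when g is a proper similitude, since the hypothesis on the
  extended representation only gives information where that operator is already known to be
  bijective on L^2.  Bijectivity is derived from the bijectivity of the dilations, together with
  sigma-finiteness of the measure on the cone.
*)

theory Submission
  imports Defs
begin

section \<open>Bilinear forms and similitudes\<close>

text \<open>The obstacle is the encoding of operators. Multiplication in \<open>BijGroup\<close>
  takes an unspecified value off the bijections, and \<open>parabolic_op\<close> is a union over all
  representatives of a class, which collapses to one class only once the substitution by (a, g) is
  known to pull null sets back to null sets. For a proper similitude neither property is available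
  at the outset. Quasi-invariance of the measure is not obtained by a change of variables on the
  cone. It is extracted from the bare fact that an operator maps \<open>L2 M\<close> into itself, by
  altering the zero function on a null set. Sigma-finiteness supplies there a piece of finite
  positive measure, whose indicator is square integrable; compactness of balls in the field enters
  only to prove sigma-finiteness. If bijectivity failed at both (a, g) and (ba, g), the extended
  representation would take the same unspecified value at both, and the dilation by b would be the
  identity. For \<open>absval b > 1\<close> this forces the cone to have measure zero, and then
  \<open>L2 M\<close> is a single point on which every such operator is bijective.\<close>

lemma bform_eq_sum:
  "bform A v w = (\<Sum>i\<in>UNIV. \<Sum>j\<in>UNIV. v $ i * A $ i $ j * w $ j)"
  unfolding bform_def vector_matrix_mult_def
  by (simp add: sum_distrib_right) (rule sum.swap)

lemma bform_add_left: "bform A (u + v) w = bform A u w + bform A v w"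
  by (simp add: bform_eq_sum distrib_right sum.distrib)

lemma bform_add_right: "bform A u (v + w) = bform A u v + bform A u w"
  by (simp add: bform_eq_sum distrib_left sum.distrib)

lemma bform_scale_left: "bform A (c *s v) w = c * bform A v w"
  by (simp add: bform_eq_sum sum_distrib_left ac_simps)

lemma bform_scale_right: "bform A v (c *s w) = c * bform A v w"
  by (simp add: bform_eq_sum sum_distrib_left ac_simps)

lemma bform_zero [simp]: "bform A 0 w = 0" "bform A v 0 = 0"
  by (simp_all add: bform_eq_sum)

lemma bform_commute:
  assumes "transpose A = A"
  shows "bform A v w = bform A w v"
proof -
  have "A $ i $ j = A $ j $ i" for i j
    by (metis assms transpose_def vec_lambda_beta)
  then show ?thesis
    unfolding bform_eq_sum by (subst sum.swap) (simp add: ac_simps)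
qed

lemma bform_axis: "bform A (axis i 1) (axis j 1) = A $ i $ j"
  by (simp add: bform_def axis_def vector_matrix_mult_def mult_delta_left mult_delta_right)

lemma bform_eq_mult_vector: "bform A v w = (\<Sum>i\<in>UNIV. v $ i * (A *v w) $ i)"
  by (simp add: bform_eq_sum matrix_vector_mult_def sum_distrib_left ac_simps)

lemma bform_eqI:
  assumes "\<And>v w. bform A v w = bform B v w"
  shows "A = B"
  using assms[of "axis i 1" "axis j 1" for i j] by (simp add: bform_axis vec_eq_iff)

lemma bform_similar:
  fixes A g :: "'f::field^'i^'i"
  shows "bform (g ** A ** transpose g) v w = bform A (v v* g) (w v* g)"
proof -
  have "bform B v (w v* g) = bform (B ** transpose g) v w" for B :: "'f^'i^'i" and v w
    by (simp add: bform_eq_mult_vector flip: matrix_vector_mul_assoc)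
  moreover have "bform B (v v* g) u = bform (g ** B) v u" for B :: "'f^'i^'i" and v u
    by (simp add: bform_def vector_matrix_mul_assoc)
  ultimately show ?thesis
    by (simp add: matrix_mul_assoc)
qed

lemma bform_scale_matrix: "bform (\<chi> i j. c * A $ i $ j) v w = c * bform A v w"
  by (simp add: bform_eq_sum sum_distrib_left ac_simps)

text \<open>A matrix is determined by its bilinear form. This replaces the entrywise scaled Gram
  matrix of the definitions by a condition on vectors, the form in which later membership tests are
  carried out.\<close>

lemma similitude_eq_iff:
  fixes A g :: "'f::field^'i^'i"
  shows "g ** A ** transpose g = (\<chi> i j. c * A $ i $ j) \<longleftrightarrow>
    (\<forall>v w. bform A (v v* g) (w v* g) = c * bform A v w)"
  using bform_eqI[of "g ** A ** transpose g" "\<chi> i j. c * A $ i $ j"]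
  by (metis bform_scale_matrix bform_similar)

lemma mat_mult_mat: "mat c ** mat d = (mat (c * d) :: 'f::semiring_1^'n^'n)"
  by (simp add: matrix_matrix_mult_def mat_def vec_eq_iff mult_delta_left)

text \<open>With \<open>A ** B = mat 1\<close>, the scaling identity exhibits
  \<open>A ** transpose g ** B ** mat (inverse c)\<close> as a right inverse of \<open>g\<close>,
  which suffices for a square matrix.\<close>

lemma invertible_similitude:
  fixes A :: "'f::field^'i^'i"
  assumes "invertible A" "c \<noteq> 0" "\<And>v w. bform A (v v* g) (w v* g) = c * bform A v w"
  shows "invertible g"
proof -
  obtain B where B: "A ** B = mat 1"
    using assms(1) invertible_def by blast
  have "g ** A ** transpose g = (\<chi> i j. c * A $ i $ j)"
    using assms(3) similitude_eq_iff by blast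
  also have "\<dots> = mat c ** A"
    by (simp add: matrix_matrix_mult_def mat_def vec_eq_iff mult_delta_left mult_delta_right)
  finally have "g ** (A ** transpose g ** B ** mat (inverse c)) = mat c ** (A ** B) ** mat (inverse c)"
    by (simp add: matrix_mul_assoc)
  also have "\<dots> = mat 1"
    using assms(2) by (simp add: B mat_mult_mat)
  finally show ?thesis
    using invertible_right_inverse by blast
qed

lemma mem_orth_sim_group_iff:
  fixes A :: "'f::field^'i^'i"
  assumes "invertible A"
  shows "g \<in> carrier (orth_sim_group A) \<longleftrightarrow>
    (\<exists>c. c \<noteq> 0 \<and> (\<forall>v w. bform A (v v* g) (w v* g) = c * bform A v w))"
  using invertible_similitude[OF assms]
  by (auto simp: orth_sim_group_def similitude_eq_iff)

lemma mem_orth_group_iff: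
  fixes A :: "'f::field^'i^'i"
  assumes "invertible A"
  shows "g \<in> carrier (orth_group A) \<longleftrightarrow> (\<forall>v w. bform A (v v* g) (w v* g) = bform A v w)"
  using invertible_similitude[OF assms, of 1 g] similitude_eq_iff[of g A 1]
  by (auto simp: orth_group_def)

lemma orth_group_subset_sim:
  "carrier (orth_group A) \<subseteq> carrier (orth_sim_group (A :: 'f::field^'i^'i))"
  by (auto simp: orth_group_def orth_sim_group_def intro!: exI[of _ 1])

lemma mat_1_mem_orth:
  fixes A :: "'f::field^'i^'i"
  assumes "invertible A"
  shows "mat 1 \<in> carrier (orth_group A)"
  by (simp add: mem_orth_group_iff assms)

lemma mat_1_mem_sim:
  fixes A :: "'f::field^'i^'i"
  assumes "invertible A"
  shows "mat 1 \<in> carrier (orth_sim_group A)"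
  using mat_1_mem_orth[OF assms] orth_group_subset_sim by blast

text \<open>An invertible matrix has a nonzero entry, and the form values at the corresponding basis
  vectors determine the factor. This uniqueness evaluates the definite description in
  \<open>sim_norm\<close>.\<close>

lemma sim_norm_eq:
  fixes A :: "'f::field^'i^'i"
  assumes "invertible A" "\<And>v w. bform A (v v* g) (w v* g) = c * bform A v w"
  shows "sim_norm A g = c"
proof -
  obtain i j where ij: "A $ i $ j \<noteq> 0"
  proof (rule ccontr)
    assume "\<not> thesis"
    then have "A = 0"
      using that by (auto simp: vec_eq_iff)
    moreover obtain B where "A ** B = mat 1"
      using assms(1) invertible_def by blast
    ultimately have "(0 ** B) $ k $ k = (mat 1 :: 'f^'i^'i) $ k $ k" for k
      by simp
    then show False
      by (simp add: matrix_matrix_mult_def mat_def)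
  qed
  have "c' = c" if "\<And>v w. bform A (v v* g) (w v* g) = c' * bform A v w" for c'
    using that[of "axis i 1" "axis j 1"] assms(2)[of "axis i 1" "axis j 1"] ij
    by (simp add: bform_axis)
  then show ?thesis
    unfolding sim_norm_def similitude_eq_iff using assms(2) by (intro the_equality) auto
qed

lemma sim_norm_one [simp]:
  fixes A :: "'f::field^'i^'i"
  assumes "invertible A"
  shows "sim_norm A (mat 1) = 1"
  using assms by (intro sim_norm_eq) simp_all

lemma bform_sim_norm:
  fixes A :: "'f::field^'i^'i"
  assumes "invertible A" "g \<in> carrier (orth_sim_group A)"
  shows "bform A (v v* g) (w v* g) = sim_norm A g * bform A v w"
  using assms sim_norm_eq mem_orth_sim_group_iff by metis

lemma sim_norm_nonzero:
  fixes A :: "'f::field^'i^'i"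
  assumes "invertible A" "g \<in> carrier (orth_sim_group A)"
  shows "sim_norm A g \<noteq> 0"
  using assms sim_norm_eq mem_orth_sim_group_iff by metis

lemma mult_mem_orth_sim_group:
  fixes A :: "'f::field^'i^'i"
  assumes "invertible A" "g \<in> carrier (orth_sim_group A)" "h \<in> carrier (orth_sim_group A)"
  shows "g ** h \<in> carrier (orth_sim_group A)"
  unfolding mem_orth_sim_group_iff[OF assms(1)]
  using bform_sim_norm[OF assms(1,2)] bform_sim_norm[OF assms(1,3)]
    sim_norm_nonzero[OF assms(1,2)] sim_norm_nonzero[OF assms(1,3)]
  by (intro exI[of _ "sim_norm A h * sim_norm A g"]) (simp flip: vector_matrix_mul_assoc)

lemma group_orth_sim_group:
  fixes A :: "'f::field^'i^'i"
  assumes "invertible A"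
  shows "group (orth_sim_group A)"
proof (rule groupI)
  fix x y z
  assume x: "x \<in> carrier (orth_sim_group A)"
  show "\<one>\<^bsub>orth_sim_group A\<^esub> \<otimes>\<^bsub>orth_sim_group A\<^esub> x = x"
    by (simp add: orth_sim_group_def)
  have "invertible x"
    using x by (simp add: orth_sim_group_def)
  then obtain y where y: "y ** x = mat 1"
    by (auto simp: invertible_def)
  have "bform A (v v* y) (w v* y) = inverse (sim_norm A x) * bform A v w" for v w
    using bform_sim_norm[OF assms x, of "v v* y" "w v* y"] sim_norm_nonzero[OF assms x]
    by (simp add: vector_matrix_mul_assoc y field_simps)
  then have "y \<in> carrier (orth_sim_group A)"
    unfolding mem_orth_sim_group_iff[OF assms] using sim_norm_nonzero[OF assms x]
    by (intro exI[of _ "inverse (sim_norm A x)"]) simp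
  then show "\<exists>y\<in>carrier (orth_sim_group A).
      y \<otimes>\<^bsub>orth_sim_group A\<^esub> x = \<one>\<^bsub>orth_sim_group A\<^esub>"
    using y by (auto simp: orth_sim_group_def)
next
  show "\<one>\<^bsub>orth_sim_group A\<^esub> \<in> carrier (orth_sim_group A)"
    by (auto simp: orth_sim_group_def transpose_mat invertible_def intro!: exI[of _ 1] exI[of _ "mat 1"])
qed (use mult_mem_orth_sim_group[OF assms] in
  \<open>auto simp: orth_sim_group_def matrix_mul_assoc\<close>)


section \<open>The hyperbolic extension\<close>

definition mid :: "'f^('d plus_index) \<Rightarrow> 'f^('d::finite)"
  where "mid v = (\<chi> k. v $ Mid k)"

definition plus_vec :: "'f \<Rightarrow> 'f^'d \<Rightarrow> 'f \<Rightarrow> 'f^(('d::finite) plus_index)"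
  where "plus_vec a v b = (\<chi> i. case i of Fst \<Rightarrow> a | Mid k \<Rightarrow> v $ k | Lst \<Rightarrow> b)"

lemma plus_vec_simps [simp]:
  "plus_vec a v b $ Fst = a" "plus_vec a v b $ Lst = b" "plus_vec a v b $ Mid k = v $ k"
  "mid (plus_vec a v b) = v" "mid u $ k = u $ Mid k"
  by (simp_all add: plus_vec_def mid_def vec_eq_iff)

lemma plus_vec_eq_iff: "u = w \<longleftrightarrow> u $ Fst = w $ Fst \<and> mid u = mid w \<and> u $ Lst = w $ Lst"
  by (auto simp: vec_eq_iff) (metis plus_index.exhaust)

lemma sum_plus_index:
  "sum f (UNIV :: 'd::finite plus_index set) = f Fst + (\<Sum>k\<in>UNIV. f (Mid k)) + f Lst"
proof -
  have *: "UNIV = insert Fst (insert Lst (range (Mid :: 'd \<Rightarrow> 'd plus_index)))"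
    by (auto intro: plus_index.exhaust)
  show ?thesis
    unfolding * by (simp add: image_iff sum.reindex inj_def comp_def ac_simps)
qed

lemma bform_gram_plus:
  "bform (gram_plus J) u w = u $ Fst * w $ Lst + bform J (mid u) (mid w) + u $ Lst * w $ Fst"
  by (simp add: bform_eq_sum sum_plus_index gram_plus_def)

lemma gram_plus_mult:
  assumes "A ** B = mat 1"
  shows "gram_plus A ** gram_plus B = mat 1"
  using assms
  by (auto simp: gram_plus_def matrix_matrix_mult_def mat_def vec_eq_iff sum_plus_index
      split: plus_index.splits)

lemma invertible_gram_plus: "invertible J \<Longrightarrow> invertible (gram_plus J)"
  unfolding invertible_def using gram_plus_mult by blast

lemma mult_m_mat:
  "u v* m_mat J a g = plus_vec (a * sim_norm J g * u $ Fst) (mid u v* g) (u $ Lst / a)"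
  unfolding plus_vec_eq_iff
  by (simp add: vector_matrix_mult_def m_mat_def sum_plus_index vec_eq_iff divide_inverse ac_simps)

lemma mult_n_mat:
  "u v* n_mat J v = plus_vec (u $ Fst) (u $ Fst *s v + mid u)
     (u $ Lst - u $ Fst * qform J v - bform J (mid u) v)"
  unfolding plus_vec_eq_iff
  by (simp add: vector_matrix_mult_def n_mat_def sum_plus_index vec_eq_iff bform_eq_mult_vector
      sum_negf mult_delta_left mult_delta_right)

lemma mult_w0_mat: "u v* w0_mat = plus_vec (u $ Lst) (mid u) (u $ Fst)"
  unfolding plus_vec_eq_iff
  by (simp add: vector_matrix_mult_def w0_mat_def sum_plus_index vec_eq_iff
      mult_delta_left mult_delta_right)

lemma matrix_eqI:
  fixes A B :: "'f::semiring_1^'n^'m"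
  assumes "\<And>u. u v* A = u v* B"
  shows "A = B"
proof -
  have "axis i 1 v* C = C $ i" for C :: "'f^'n^'m" and i
    by (simp add: vector_matrix_mult_def axis_def vec_eq_iff mult_delta_left mult_delta_right)
  then show ?thesis
    by (metis assms vec_eq_iff)
qed

section \<open>Generators of the similitude group of the hyperbolic extension\<close>

context
  fixes J :: "'f::field_char_0^'d^'d"
  assumes sym: "transpose J = J" and inv: "invertible J"
begin

lemma n_mat_orth: "n_mat J v \<in> carrier (orth_group (gram_plus J))"
  unfolding mem_orth_group_iff[OF invertible_gram_plus[OF inv]]
proof (intro allI)
  fix u w
  \<comment> \<open>The contribution of \<open>v\<close> cancels: the two corner terms against
    \<open>bform J v v\<close>, and the mixed terms in pairs, by symmetry of
    \<open>J\<close>.\<close>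
  have "bform J v v = 2 * qform J v" "bform J v (mid w) = bform J (mid w) v"
    by (simp_all add: qform_def bform_commute[OF sym])
  then show "bform (gram_plus J) (u v* n_mat J v) (w v* n_mat J v) = bform (gram_plus J) u w"
    by (simp add: mult_n_mat bform_gram_plus bform_add_left bform_add_right bform_scale_left
        bform_scale_right algebra_simps)
qed

text \<open>The corner entries \<open>a * sim_norm J g\<close> and \<open>inverse a\<close> multiply
  to \<open>sim_norm J g\<close>, so the hyperbolic plane is scaled by the same factor as
  \<open>V\<close>.\<close>

lemma m_mat_sim:
  assumes "a \<noteq> 0" "g \<in> carrier (orth_sim_group J)"
  shows "m_mat J a g \<in> carrier (orth_sim_group (gram_plus J))"
  unfolding mem_orth_sim_group_iff[OF invertible_gram_plus[OF inv]]
  using assms sim_norm_nonzero[OF inv assms(2)]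
  by (intro exI[of _ "sim_norm J g"])
    (simp add: mult_m_mat bform_gram_plus bform_sim_norm[OF inv] field_simps)

lemma w0_mat_orth: "w0_mat \<in> carrier (orth_group (gram_plus J))"
  unfolding mem_orth_group_iff[OF invertible_gram_plus[OF inv]]
  by (simp add: mult_w0_mat bform_gram_plus)

lemma n_mat_zero: "n_mat J 0 = mat 1"
  by (rule matrix_eqI) (simp add: mult_n_mat plus_vec_eq_iff qform_def)

lemma m_mat_one: "m_mat J 1 (mat 1) = mat 1"
  by (rule matrix_eqI) (simp add: mult_m_mat plus_vec_eq_iff inv)

lemma m_mat_mult:
  assumes "a \<noteq> 0" "b \<noteq> 0"
  shows "m_mat J a (mat 1) ** m_mat J b g = m_mat J (a * b) g"
  using assms
  by (intro matrix_eqI)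
    (simp add: mult_m_mat plus_vec_eq_iff inv field_simps flip: vector_matrix_mul_assoc)

lemma exists_bform_eq_1:
  assumes "u \<noteq> 0"
  obtains v where "bform J u v = 1"
proof -
  have "u v* J \<noteq> 0"
  proof
    assume "u v* J = 0"
    moreover obtain B where "J ** B = mat 1"
      using inv invertible_def by blast
    ultimately have "u = 0"
      by (metis vector_matrix_mul_assoc vector_matrix_mul_rid vector_matrix_mult_0)
    with assms show False
      by simp
  qed
  then obtain k where k: "(u v* J) $ k \<noteq> 0"
    by (auto simp: vec_eq_iff)
  have "bform J u (axis k (1 / (u v* J) $ k)) = 1"
    using k by (simp add: bform_def axis_def mult_delta_left mult_delta_right)
  then show ?thesis
    using that by blast
qed

text \<open>Indexed by the same triples as the operators generating the modulation group, so that
  \<open>T\<close> will match the two sets element by element.\<close>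

definition parabolic_generators :: "('f^('d plus_index)^('d plus_index)) set"
  where "parabolic_generators =
    {n_mat J v ** m_mat J a g | v a g. a \<noteq> 0 \<and> g \<in> carrier (orth_sim_group J)}"

abbreviation gen
  where "gen \<equiv> generate (orth_sim_group (gram_plus J)) (insert w0_mat parabolic_generators)"

lemma gen_mult: "x \<in> gen \<Longrightarrow> y \<in> gen \<Longrightarrow> x ** y \<in> gen"
  using generate.eng[of x "orth_sim_group (gram_plus J)" _ y] by (simp add: orth_sim_group_def)

lemma w0_mem_gen: "w0_mat \<in> gen"
  by (rule generate.incl) simp

lemma n_mem_gen: "n_mat J v \<in> gen"
proof -
  have "n_mat J v ** m_mat J 1 (mat 1) \<in> parabolic_generators"
    using mat_1_mem_sim[OF inv] unfolding parabolic_generators_def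
    by (metis (mono_tags, lifting) mem_Collect_eq one_neq_zero)
  then show ?thesis
    by (auto simp: m_mat_one intro: generate.incl)
qed

lemma m_mem_gen:
  assumes "a \<noteq> 0" "g \<in> carrier (orth_sim_group J)"
  shows "m_mat J a g \<in> gen"
proof -
  have "n_mat J 0 ** m_mat J a g \<in> parabolic_generators"
    using assms unfolding parabolic_generators_def by blast
  then show ?thesis
    by (auto simp: n_mat_zero intro: generate.incl)
qed

lemma parabolic_generators_subset:
  "insert w0_mat parabolic_generators \<subseteq> carrier (orth_sim_group (gram_plus J))"
  unfolding parabolic_generators_def
  using n_mat_orth[THEN orth_group_subset_sim[THEN subsetD]] m_mat_sim
    w0_mat_orth[THEN orth_group_subset_sim[THEN subsetD]]
  by (auto intro!: mult_mem_orth_sim_group invertible_gram_plus[OF inv])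

lemma isotropic_to_Lst:
  assumes "u \<noteq> 0" and iso: "bform (gram_plus J) u u = 0"
  obtains y where "y \<in> gen" "u v* y = plus_vec 0 0 1"
proof -
  have step: "\<exists>y\<in>gen. u v* y = plus_vec 0 0 1"
    if "u $ Fst \<noteq> 0" and iso: "bform (gram_plus J) u u = 0" for u
  proof -
    define f where "f = u $ Fst"
    \<comment> \<open>With this \<open>v\<close>, \<open>n_mat J v\<close> clears the middle of
      \<open>u\<close>, and isotropy makes the last coordinate vanish as well, leaving
      \<open>plus_vec f 0 0\<close>; \<open>w0_mat\<close> moves \<open>f\<close> to the end and
      \<open>m_mat J f (mat 1)\<close> divides it by \<open>f\<close>.\<close>
    define v where "v = (- inverse f) *s mid u"
    define y where "y = n_mat J v ** w0_mat ** m_mat J f (mat 1)"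
    have f: "f \<noteq> 0"
      using that f_def by simp
    have "f *s v + mid u = 0"
      using f by (simp add: v_def vec_eq_iff)
    moreover have "u $ Lst - f * qform J v - bform J (mid u) v = 0"
      using iso f unfolding bform_gram_plus f_def[symmetric] qform_def v_def
        bform_scale_left bform_scale_right
      by (simp add: field_simps)
    ultimately have "u v* y = plus_vec 0 0 1"
      using f unfolding y_def
      by (simp add: mult_n_mat mult_w0_mat mult_m_mat f_def plus_vec_eq_iff
          flip: vector_matrix_mul_assoc)
    moreover have "y \<in> gen"
      unfolding y_def using f mat_1_mem_sim[OF inv]
      by (intro gen_mult n_mem_gen w0_mem_gen m_mem_gen)
    ultimately show ?thesis
      by blast
  qed
  have step': "\<exists>y\<in>gen. u v* y = plus_vec 0 0 1"
    if nz: "u $ Lst \<noteq> 0" and iso: "bform (gram_plus J) u u = 0" for u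
  proof -
    have "bform (gram_plus J) (u v* w0_mat) (u v* w0_mat) = 0"
      using iso by (simp add: mult_w0_mat bform_gram_plus ac_simps)
    then obtain y where "y \<in> gen" "(u v* w0_mat) v* y = plus_vec 0 0 1"
      using step[of "u v* w0_mat"] nz by (auto simp: mult_w0_mat)
    then show ?thesis
      using gen_mult w0_mem_gen by (metis vector_matrix_mul_assoc)
  qed
  show ?thesis
  proof (cases "u $ Fst = 0 \<and> u $ Lst = 0")
    case True
    then have "mid u \<noteq> 0"
      using assms(1) by (auto simp: plus_vec_eq_iff mid_def vec_eq_iff)
    \<comment> \<open>Both outer coordinates vanish here; \<open>n_mat J v\<close> creates the last
      coordinate \<open>- bform J (mid u) v\<close>, that is -1, and \<open>step'\<close>
      applies.\<close>
    then obtain v where v: "bform J (mid u) v = 1"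
      by (rule exists_bform_eq_1)
    obtain y where "y \<in> gen" "(u v* n_mat J v) v* y = plus_vec 0 0 1"
      using step'[of "u v* n_mat J v"] v True iso by (auto simp: mult_n_mat bform_gram_plus)
    then show ?thesis
      using gen_mult n_mem_gen that by (metis vector_matrix_mul_assoc)
  next
    case False
    then show ?thesis
      using step step' iso that by blast
  qed
qed

text \<open>Stated for \<open>x ** n_mat J v\<close>, so that no inverse of \<open>n_mat J v\<close>
  has to be computed; the factor is cancelled later inside the generated subgroup.\<close>

lemma stabilizer_mem_parabolic:
  assumes x: "x \<in> carrier (orth_sim_group (gram_plus J))"
    and fix_Lst: "plus_vec 0 0 1 v* x = plus_vec 0 0 1"
  obtains v g where "g \<in> carrier (orth_sim_group J)" "x ** n_mat J v = m_mat J 1 g"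
proof -
  let ?P = "gram_plus J"
  note inv' = invertible_gram_plus[OF inv]
  define c where "c = sim_norm ?P x"
  define eF :: "'f^('d plus_index)" where "eF = plus_vec 1 0 0"
  define eL :: "'f^('d plus_index)" where "eL = plus_vec 0 0 1"
  have c: "c \<noteq> 0" and pres: "bform ?P (u v* x) (w v* x) = c * bform ?P u w" for u w
    using sim_norm_nonzero[OF inv' x] bform_sim_norm[OF inv' x] by (simp_all add: c_def)
  \<comment> \<open>The first coordinate of a vector is its pairing with \<open>eL\<close>, which
    \<open>x\<close> fixes.\<close>
  have Fst_x: "(u v* x) $ Fst = c * u $ Fst" for u
    using pres[of u eL] fix_Lst by (simp add: eL_def bform_gram_plus)
  \<comment> \<open>Chosen so that \<open>n_mat J v\<close> cancels the middle part of
    \<open>eF v* x\<close>, whose first coordinate is \<open>c\<close>.\<close>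
  define v where "v = (- inverse c) *s mid (eF v* x)"
  define y where "y = x ** n_mat J v"
  define g :: "'f^'d^'d" where "g = (\<chi> k. mid (axis (Mid k) 1 v* y))"
  have pres_y: "bform ?P (u v* y) (w v* y) = c * bform ?P u w" for u w
    using n_mat_orth pres unfolding y_def
    by (metis inv' mem_orth_group_iff vector_matrix_mul_assoc)
  have Fst_y: "(u v* y) $ Fst = c * u $ Fst" for u
    unfolding y_def by (simp add: mult_n_mat Fst_x flip: vector_matrix_mul_assoc)
  have L: "eL v* y = eL"
    using fix_Lst unfolding y_def
    by (simp add: eL_def mult_n_mat plus_vec_eq_iff flip: vector_matrix_mul_assoc)
  have "mid (eF v* y) = 0"
    unfolding y_def using c Fst_x[of eF]
    by (simp add: mult_n_mat v_def vec_eq_iff eF_def flip: vector_matrix_mul_assoc)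
  \<comment> \<open>\<open>eF v* y\<close> is isotropic with zero middle part, so the product of its
    outer coordinates vanishes, and the first one is \<open>c\<close>.\<close>
  moreover from this have "(eF v* y) $ Lst = 0"
    using pres_y[of eF eF] c Fst_y[of eF] by (simp add: bform_gram_plus eF_def)
  ultimately have F: "eF v* y = plus_vec c 0 0"
    using Fst_y[of eF] by (simp add: plus_vec_eq_iff) (simp add: eF_def)
  have M: "plus_vec 0 r 0 v* y = plus_vec 0 (r v* g) 0" for r
  proof -
    let ?r = "plus_vec 0 r 0"
    \<comment> \<open>\<open>?r\<close> is orthogonal to \<open>eF\<close>, and
      \<open>eF v* y\<close> is by now \<open>plus_vec c 0 0\<close>.\<close>
    have "(?r v* y) $ Lst = 0"
      using pres_y[of ?r eF] c by (simp add: F bform_gram_plus) (simp add: eF_def)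
    moreover have "mid (?r v* y) = r v* g"
      by (simp add: g_def vector_matrix_mult_def vec_eq_iff sum_plus_index axis_def
          mult_delta_left mult_delta_right)
    ultimately show ?thesis
      by (simp add: plus_vec_eq_iff Fst_y)
  qed
  have dec: "u = u $ Fst *s eF + plus_vec 0 (mid u) 0 + u $ Lst *s eL" for u :: "'f^('d plus_index)"
    unfolding plus_vec_eq_iff by (simp add: eF_def eL_def vec_eq_iff)
  have g: "bform J (v v* g) (w v* g) = c * bform J v w" for v w
    using pres_y[of "plus_vec 0 v 0" "plus_vec 0 w 0"] by (simp add: M bform_gram_plus)
  have "y = m_mat J 1 g"
  proof (rule matrix_eqI)
    fix u
    have "u v* y = u $ Fst *s (eF v* y) + plus_vec 0 (mid u) 0 v* y + u $ Lst *s (eL v* y)"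
      by (subst dec[of u]) (simp only: vector_matrix_left_distrib scalar_vector_matrix_assoc)
    also have "\<dots> = u v* m_mat J 1 g"
      using sim_norm_eq[OF inv g]
      by (simp add: F M L[unfolded eL_def] mult_m_mat plus_vec_eq_iff vec_eq_iff eL_def)
    finally show "u v* y = u v* m_mat J 1 g" .
  qed
  moreover have "g \<in> carrier (orth_sim_group J)"
    using g c mem_orth_sim_group_iff[OF inv] by blast
  ultimately show ?thesis
    using that unfolding y_def by blast
qed

lemma orth_sim_group_generated:
  "generate (orth_sim_group (gram_plus J)) (insert w0_mat parabolic_generators) =
    carrier (orth_sim_group (gram_plus J))"
proof
  let ?G = "orth_sim_group (gram_plus J)"
  interpret group ?G
    by (rule group_orth_sim_group) (rule invertible_gram_plus[OF inv])
  show "gen \<subseteq> carrier ?G"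
    by (rule generate_incl) (rule parabolic_generators_subset)
  have sub: "subgroup gen ?G"
    by (rule generate_is_subgroup) (rule parabolic_generators_subset)
  \<comment> \<open>Both reductions below multiply on the right by elements of \<open>gen\<close>;
    this removes those factors again.\<close>
  have cancel: "x \<in> gen" if "x \<in> carrier ?G" "x ** y \<in> gen" "y \<in> gen" for x y
  proof -
    have mult_G: "x \<otimes>\<^bsub>?G\<^esub> y = x ** y"
      by (simp add: orth_sim_group_def)
    have "y \<in> carrier ?G"
      using sub that(3) by (rule subgroup.mem_carrier)
    then have "x = (x \<otimes>\<^bsub>?G\<^esub> y) \<otimes>\<^bsub>?G\<^esub> inv\<^bsub>?G\<^esub> y"
      using that(1) by (simp add: m_assoc)
    also have "\<dots> \<in> gen"
      unfolding mult_G using sub that(2,3) by (intro subgroup.m_closed subgroup.m_inv_closed)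
    finally show ?thesis .
  qed
  show "carrier ?G \<subseteq> gen"
  proof
    fix x
    assume x: "x \<in> carrier ?G"
    let ?u = "plus_vec 0 0 1 v* x"
    have "bform (gram_plus J) ?u ?u = 0"
      using bform_sim_norm[OF invertible_gram_plus[OF inv] x] by (simp add: bform_gram_plus)
    moreover have "?u \<noteq> 0"
    proof
      assume "?u = 0"
      then have "bform (gram_plus J) (plus_vec 0 0 1 v* x) (plus_vec 1 0 0 v* x) = 0"
        by simp
      then show False
        using bform_sim_norm[OF invertible_gram_plus[OF inv] x]
          sim_norm_nonzero[OF invertible_gram_plus[OF inv] x]
        by (simp add: bform_gram_plus)
    qed
    ultimately obtain y where y: "y \<in> gen" "?u v* y = plus_vec 0 0 1"
      by (metis isotropic_to_Lst)
    have xy: "x ** y \<in> carrier ?G"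
      using x y(1) \<open>gen \<subseteq> carrier ?G\<close>
      by (intro mult_mem_orth_sim_group invertible_gram_plus[OF inv]) auto
    obtain v g where "g \<in> carrier (orth_sim_group J)" "x ** y ** n_mat J v = m_mat J 1 g"
      using stabilizer_mem_parabolic[OF xy] y(2) by (metis vector_matrix_mul_assoc)
    then have "x ** y ** n_mat J v \<in> gen"
      by (simp add: m_mem_gen)
    then have "x ** y \<in> gen"
      using cancel xy n_mem_gen by blast
    then show "x \<in> gen"
      using cancel x y(1) by blast
  qed
qed

end


section \<open>Valued fields\<close>

lemma absval_0 [simp]: "absval 0 = 0"
  by (simp add: absval_def)

lemma absval_eq_0_iff [simp]: "absval x = 0 \<longleftrightarrow> x = 0"
  by (simp add: absval_def)

lemma absval_nonneg [simp]: "0 \<le> absval x"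
  by (simp add: absval_def)

lemma absval_pos_iff [simp]: "0 < absval x \<longleftrightarrow> x \<noteq> 0"
  by (simp add: absval_def)

lemma absval_mult: "absval (x * y) = absval x * absval y"
  by (simp add: absval_def dist_mult_0)

lemma dist_eq_absval: "dist x y = absval (x - y)"
  unfolding absval_def by (rule dist_eq_dist_diff_0)

lemma absval_1 [simp]: "absval 1 = 1"
  using absval_mult[of 1 "1 :: 'a"] by simp

lemma absval_minus [simp]: "absval (- x) = absval x"
  by (metis absval_def diff_0 dist_commute dist_eq_absval)

lemma absval_inverse: "absval (inverse x) = inverse (absval x)"
proof (cases "x = 0")
  case False
  then have "absval x * absval (inverse x) = 1"
    by (simp flip: absval_mult)
  then show ?thesis
    by (metis inverse_unique)
qed simp

lemma absval_divide: "absval (x / y) = absval x / absval y"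
  by (simp add: divide_inverse absval_mult absval_inverse)

lemma absval_power: "absval (x ^ k) = absval x ^ k"
  by (induction k) (simp_all add: absval_mult)

lemma absval_add_le: "absval (x + y) \<le> absval x + absval y"
  using dist_triangle[of "x + y" 0 y] by (simp add: dist_eq_absval)

text \<open>\<open>valued_field_0\<close> is only a field with a metric; continuity of addition
  comes from translation invariance of the metric, through the triangle inequality for
  \<open>absval\<close>.\<close>

lemma tendsto_add_valued:
  fixes a b :: "'f::valued_field_0"
  assumes "(f \<longlongrightarrow> a) F" "(g \<longlongrightarrow> b) F"
  shows "((\<lambda>x. f x + g x) \<longlongrightarrow> a + b) F"
proof -
  have "((\<lambda>x. dist (f x) a + dist (g x) b) \<longlongrightarrow> 0 + 0) F"
    by (intro tendsto_add tendsto_dist_iff[THEN iffD1] assms)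
  then have lim: "((\<lambda>x. dist (f x) a + dist (g x) b) \<longlongrightarrow> 0) F"
    by simp
  have "dist (f x + g x) (a + b) \<le> dist (f x) a + dist (g x) b" for x
    using absval_add_le[of "f x - a" "g x - b"] by (simp add: dist_eq_absval algebra_simps)
  then have "((\<lambda>x. dist (f x + g x) (a + b)) \<longlongrightarrow> 0) F"
    by (intro tendsto_sandwich[OF _ _ tendsto_const lim]) auto
  then show ?thesis
    by (rule tendsto_dist_iff[THEN iffD2])
qed

lemma tendsto_mult_left_valued:
  fixes a c :: "'f::valued_field_0"
  assumes "(f \<longlongrightarrow> a) F"
  shows "((\<lambda>x. c * f x) \<longlongrightarrow> c * a) F"
proof -
  have "((\<lambda>x. absval c * dist (f x) a) \<longlongrightarrow> absval c * 0) F"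
    by (intro tendsto_mult_left tendsto_dist_iff[THEN iffD1] assms)
  then show ?thesis
    unfolding tendsto_dist_iff[of _ "c * a"]
    by (simp add: dist_eq_absval absval_mult flip: right_diff_distrib)
qed

text \<open>One statement for the linear maps needed below: the coordinates of
  \<open>a *s (v v* g)\<close> and of \<open>J *v v\<close>, and the functional
  \<open>bform J v\<close>.\<close>

lemma continuous_on_sum_mult_valued:
  fixes w :: "'d::finite \<Rightarrow> 'f::valued_field_0"
  shows "continuous_on UNIV (\<lambda>v :: 'f^'d. \<Sum>j\<in>I. w j * v $ j)"
proof (induction I rule: infinite_finite_induct)
  case (insert j I)
  then show ?case
    by (auto simp: continuous_on_def intro!: tendsto_add_valued tendsto_mult_left_valued
        tendsto_vec_nth tendsto_ident_at)
qed simp_all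

lemma continuous_on_scale_mult_vec:
  fixes g :: "'f::valued_field_0^'d^'d"
  shows "continuous_on UNIV (\<lambda>v. a *s (v v* g))"
proof -
  have "(\<lambda>v. a *s (v v* g)) = (\<lambda>v. \<chi> j. \<Sum>i\<in>UNIV. (a * g $ i $ j) * v $ i)"
    by (simp add: vector_matrix_mult_def vec_eq_iff fun_eq_iff sum_distrib_left ac_simps)
  then show ?thesis
    by (simp only: continuous_on_vec_lambda continuous_on_sum_mult_valued)
qed

lemma continuous_on_mult_vec_nth:
  fixes J :: "'f::valued_field_0^'d^'d"
  shows "continuous_on UNIV (\<lambda>v. (J *v v) $ i)"
  using continuous_on_sum_mult_valued[where I = UNIV and w = "\<lambda>j. J $ i $ j"] by (simp add: matrix_vector_mult_def)

lemma continuous_on_bform_right: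
  fixes J :: "'f::valued_field_0^'d^'d"
  shows "continuous_on UNIV (\<lambda>c. bform J v c)"
  using continuous_on_sum_mult_valued[where I = UNIV and w = "\<lambda>j. (v v* J) $ j"] by (simp add: bform_def)

section \<open>Compactness of balls and sigma-finiteness of Haar measure\<close>

lemma cball_0_eq: "cball 0 r = {x. absval x \<le> r}"
  by (auto simp: absval_def dist_commute)

text \<open>The two properties through which the field enters, common to both cases of the theorem:
  compact balls make Haar measure sigma-finite, and an element with \<open>absval b > 1\<close>
  gives a dilation without invariant shells.\<close>

definition local_field :: "'f::valued_field_0 itself \<Rightarrow> bool"
  where "local_field _ \<longleftrightarrow> (\<forall>r. compact (cball (0 :: 'f) r)) \<and> (\<exists>b::'f. absval b > 1)"

lemma real_field_imp_local_field:
  assumes "is_real_field TYPE('f::valued_field_0)"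
  shows "local_field TYPE('f)"
proof -
  obtain \<phi> :: "'f \<Rightarrow> real" where bij: "bij \<phi>" and add: "\<And>x y. \<phi> (x + y) = \<phi> x + \<phi> y"
    and abs: "\<And>x. \<bar>\<phi> x\<bar> = absval x"
    using assms unfolding is_real_field_def by blast
  have diff: "\<phi> (x - y) = \<phi> x - \<phi> y" for x y
    using add[of "x - y" y] by simp
  define \<rho> where "\<rho> = inv_into UNIV \<phi>"
  have \<rho>: "\<phi> (\<rho> t) = t" "\<rho> (\<phi> x) = x" for t x
    using bij by (simp_all add: \<rho>_def bij_is_inj bij_is_surj surj_f_inv_f)
  have isometry: "dist (\<rho> s) (\<rho> t) = dist s t" for s t
    using abs[of "\<rho> s - \<rho> t"] unfolding dist_eq_absval[of "\<rho> s"] by (simp add: diff \<rho> dist_real_def)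
  then have "continuous_on UNIV \<rho>"
    unfolding continuous_on_iff by auto
  moreover have "cball 0 r = \<rho> ` {-r..r}" for r
  proof -
    have "x \<in> \<rho> ` {-r..r}" if "absval x \<le> r" for x
      using that abs[of x] \<rho>(2)[of x] by (intro image_eqI[of _ _ "\<phi> x"]) auto
    moreover have "absval (\<rho> t) \<le> r" if "t \<in> {-r..r}" for t
      using that abs[of "\<rho> t"] \<rho>(1)[of t] by auto
    ultimately show ?thesis
      by (auto simp: cball_0_eq)
  qed
  ultimately have "compact (cball (0 :: 'f) r)" for r
    by (metis compact_Icc compact_continuous_image continuous_on_subset subset_UNIV)
  moreover have "absval (\<rho> 2) > 1"
    using abs[of "\<rho> 2"] by (simp add: \<rho>)
  ultimately show ?thesis
    unfolding local_field_def by blast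
qed

text \<open>Balls are complete, and they are totally bounded by expansion in powers of
  \<open>\<pi>\<close>, with digits that represent the finite residue field.\<close>

lemma nonarchimedean_imp_local_field:
  assumes "nonarchimedean_local_field TYPE('f::valued_field_0)"
  shows "local_field TYPE('f)"
proof -
  have complete: "complete (UNIV :: 'f set)" and fin: "finite (residue_field TYPE('f))"
    using assms unfolding nonarchimedean_local_field_def by blast+
  obtain \<pi> :: 'f where pi: "0 < absval \<pi>" "absval \<pi> < 1"
    and val: "\<And>x::'f. x \<noteq> 0 \<Longrightarrow> \<exists>k::int. absval x = absval \<pi> powi k"
    using assms unfolding nonarchimedean_local_field_def by blast
  define S where "S = (\<lambda>C. SOME x. x \<in> C) ` residue_field TYPE('f)"
  have "finite S"
    using fin by (simp add: S_def)
  have S: "\<exists>s\<in>S. absval (x - s) \<le> absval \<pi>" if "absval x \<le> 1" for x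
  proof -
    let ?r = "{(x, y :: 'f). absval x \<le> 1 \<and> absval y \<le> 1 \<and> absval (x - y) < 1}"
    have C: "?r `` {x} \<in> residue_field TYPE('f)"
      unfolding residue_field_def by (rule quotientI) (use that in simp)
    have "x \<in> ?r `` {x}"
      using that by simp
    then have "(SOME y. y \<in> ?r `` {x}) \<in> ?r `` {x}"
      by (rule someI)
    moreover have "(SOME y. y \<in> ?r `` {x}) \<in> S"
      unfolding S_def using C by (rule imageI)
    ultimately obtain s where s: "s \<in> S" "absval (x - s) < 1"
      by blast
    have "absval (x - s) \<le> absval \<pi>"
    proof (cases "x = s")
      case False
      then obtain k :: int where k: "absval (x - s) = absval \<pi> powi k"
        using val[of "x - s"] by auto
      \<comment> \<open>Discreteness of the value group sharpens \<open>< 1\<close> to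
        \<open>\<le> absval \<pi>\<close>: a nonpositive exponent would give absolute value at least
        1.\<close>
      have "k \<ge> 1"
      proof (rule ccontr)
        assume "\<not> k \<ge> 1"
        then have "absval \<pi> powi 0 \<le> absval \<pi> powi k"
          using pi by (intro power_int_decreasing) auto
        then show False
          using k s(2) by simp
      qed
      then have "absval \<pi> powi k \<le> absval \<pi> powi 1"
        using pi by (intro power_int_decreasing) auto
      then show ?thesis
        using k by simp
    qed simp
    then show ?thesis
      using s(1) by blast
  qed
  have cover: "\<exists>K. finite K \<and> (\<forall>x::'f. absval x \<le> 1 \<longrightarrow> (\<exists>s\<in>K. absval (x - s) \<le> absval \<pi> ^ k))" for k
  proof (induction k)
    case 0
    then show ?case
      by (intro exI[of _ "{0}"]) auto
  next
    case (Suc k)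
    then obtain K where K: "finite K" "\<And>x::'f. absval x \<le> 1 \<Longrightarrow> \<exists>s\<in>K. absval (x - s) \<le> absval \<pi> ^ k"
      by blast
    \<comment> \<open>One more digit: \<open>x - s\<close> divided by \<open>\<pi> ^ k\<close> lies
      in the unit ball and is approximated by an element of \<open>S\<close>.\<close>
    let ?K = "(\<lambda>(s, r). s + \<pi> ^ k * r) ` (K \<times> S)"
    have cover: "\<exists>s\<in>?K. absval (x - s) \<le> absval \<pi> ^ Suc k"
      if x: "absval x \<le> 1" for x
    proof -
      obtain s where s: "s \<in> K" "absval (x - s) \<le> absval \<pi> ^ k"
        using K(2) x by blast
      then have "absval ((x - s) / \<pi> ^ k) \<le> 1"
        using pi by (simp add: absval_divide absval_power divide_le_eq)
      then obtain r where r: "r \<in> S" "absval ((x - s) / \<pi> ^ k - r) \<le> absval \<pi>"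
        using S by blast
      have "x - (s + \<pi> ^ k * r) = \<pi> ^ k * ((x - s) / \<pi> ^ k - r)"
        using pi by (simp add: field_simps)
      then have "absval (x - (s + \<pi> ^ k * r)) \<le> absval \<pi> ^ Suc k"
        using pi r(2) by (simp add: absval_mult absval_power mult_left_mono mult.commute)
      then show ?thesis
        using s(1) r(1) by force
    qed
    show ?case
      by (intro exI[of _ ?K] conjI finite_imageI finite_cartesian_product allI impI cover K(1)
          \<open>finite S\<close>)
  qed
  have "compact (cball (0 :: 'f) R)" for R
  proof -
    have "\<exists>K. finite K \<and> cball (0 :: 'f) R \<subseteq> (\<Union>x\<in>K. ball x e)" if e: "e > 0" for e
    proof -
      obtain m where m: "absval \<pi> ^ m * R \<le> 1"
      proof -
        \<comment> \<open>\<open>max R 1\<close> keeps the bound positive when \<open>R\<close> is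
          zero or negative.\<close>
        obtain m where "absval \<pi> ^ m < inverse (max R 1)"
          using real_arch_pow_inv[of "inverse (max R 1)" "absval \<pi>"] pi
          by (auto simp: less_max_iff_disj)
        then have "absval \<pi> ^ m * max R 1 \<le> 1"
          by (simp add: field_simps max_def split: if_splits)
        then have "absval \<pi> ^ m * R \<le> 1"
          using mult_left_mono[of R "max R 1" "absval \<pi> ^ m"] by simp
        then show ?thesis
          using that by blast
      qed
      \<comment> \<open>The net of the unit ball will be divided by \<open>\<pi> ^ m\<close>, which
        enlarges its mesh by the inverse of \<open>absval \<pi> ^ m\<close>.\<close>
      obtain k where k: "absval \<pi> ^ k < e * absval \<pi> ^ m"
        using real_arch_pow_inv[of "e * absval \<pi> ^ m" "absval \<pi>"] pi e by auto
      obtain K where K: "finite K" "\<And>x::'f. absval x \<le> 1 \<Longrightarrow> \<exists>s\<in>K. absval (x - s) \<le> absval \<pi> ^ k"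
        using cover by blast
      have "\<exists>s\<in>K. dist (s / \<pi> ^ m) x < e" if "absval x \<le> R" for x
      proof -
        have "absval (\<pi> ^ m * x) \<le> 1"
          using mult_left_mono[OF that, of "absval \<pi> ^ m"] m by (simp add: absval_mult absval_power)
        then obtain s where s: "s \<in> K" "absval (\<pi> ^ m * x - s) \<le> absval \<pi> ^ k"
          using K(2) by blast
        have "x - s / \<pi> ^ m = (\<pi> ^ m * x - s) / \<pi> ^ m"
          using pi by (simp add: diff_divide_distrib)
        then have "dist (s / \<pi> ^ m) x = absval (\<pi> ^ m * x - s) / absval \<pi> ^ m"
          by (metis absval_divide absval_power dist_commute dist_eq_absval)
        also have "\<dots> < e"
          using s(2) k pi by (simp add: divide_less_eq)
        finally show ?thesis
          using s(1) by blast
      qed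
      then show ?thesis
        using K(1) by (intro exI[of _ "(\<lambda>s. s / \<pi> ^ m) ` K"]) (auto simp: cball_0_eq)
    qed
    moreover have "complete (cball (0 :: 'f) R)"
      using complete complete_closed_subset[of "cball 0 R" UNIV] by auto
    ultimately show ?thesis
      unfolding compact_eq_totally_bounded by blast
  qed
  moreover have "absval (inverse \<pi>) > 1"
    using pi by (simp add: absval_inverse one_less_inverse_iff)
  ultimately show ?thesis
    unfolding local_field_def by blast
qed

lemma sigma_finite_haar_measure:
  fixes \<mu> :: "'f::valued_field_0 measure"
  assumes "local_field TYPE('f)" "haar_measure \<mu>"
  shows "sigma_finite_measure \<mu>"
proof
  let ?A = "range (\<lambda>k::nat. cball (0 :: 'f) (real k))"
  have sets: "sets \<mu> = sets borel"
    and fin: "\<And>K. compact K \<Longrightarrow> emeasure \<mu> K < \<infinity>"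
    using assms(2) by (simp_all add: haar_measure_def)
  have "\<exists>k::nat. x \<in> cball 0 (real k)" for x :: 'f
    by (simp add: cball_0_eq real_arch_simple)
  then have "\<Union> ?A = space \<mu>"
    using sets_eq_imp_space_eq[OF sets] by auto
  moreover have "?A \<subseteq> sets \<mu>"
    unfolding sets by auto
  moreover have "\<forall>a\<in>?A. emeasure \<mu> a \<noteq> \<infinity>"
    using fin assms(1) unfolding local_field_def by (auto simp: less_top)
  ultimately show "\<exists>A. countable A \<and> A \<subseteq> sets \<mu> \<and> \<Union> A = space \<mu> \<and> (\<forall>a\<in>A. emeasure \<mu> a \<noteq> \<infinity>)"
    by (intro exI[of _ ?A]) simp
qed


section \<open>The measure on the cone is \<open>\<sigma>\<close>-finite\<close>

text \<open>On a line parallel to a coordinate axis the quadratic form is a quadratic polynomial, whose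
  derivative does not vanish in the chart.\<close>

lemma card_cone_fibre_le:
  fixes J :: "'f::field_char_0^'d^'d"
  assumes sym: "transpose J = J"
    and A: "A \<subseteq> cone_sm J" "\<And>c. c \<in> A \<Longrightarrow> (J *v c) $ i \<noteq> 0"
  shows "finite {c\<in>A. restrict (($) c) (UNIV - {i}) = y} \<and>
    card {c\<in>A. restrict (($) c) (UNIV - {i}) = y} \<le> 2"
proof (cases "{c\<in>A. restrict (($) c) (UNIV - {i}) = y} = {}")
  case True
  show ?thesis
    unfolding True by simp
next
  case False
  let ?S = "{c\<in>A. restrict (($) c) (UNIV - {i}) = y}"
  obtain c0 where c0: "c0 \<in> A" "restrict (($) c0) (UNIV - {i}) = y"
    using False by blast
  \<comment> \<open>The nonzero root of the quadratic equation for the displacement along the axis.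
    If \<open>J $ i $ i = 0\<close>, division by zero gives \<open>t = 0\<close> and the two
    candidate points coincide; the equation is then linear with nonzero slope.\<close>
  define t where "t = - 2 * (J *v c0) $ i / J $ i $ i"
  have "c \<in> {c0, c0 + axis i t}" if c: "c \<in> ?S" for c
  proof -
    define s where "s = c $ i - c0 $ i"
    have "c $ j = c0 $ j" if "j \<noteq> i" for j
      using c c0(2) that by (metis (mono_tags, lifting) DiffI UNIV_I mem_Collect_eq restrict_apply' singletonD)
    then have c_eq: "c = c0 + s *s axis i 1"
      by (auto simp: vec_eq_iff axis_def s_def)
    have iso: "bform J c c = 0" "bform J c0 c0 = 0"
      using A(1) c c0 by (auto simp: cone_sm_def qform_def)
    have "bform J (axis i 1) c0 = (J *v c0) $ i"
      by (simp add: bform_eq_mult_vector axis_def mult_delta_left)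
    then have "bform J c c = bform J c0 c0 + s * (2 * (J *v c0) $ i + s * J $ i $ i)"
      unfolding c_eq
      by (simp add: bform_add_left bform_add_right bform_scale_left bform_scale_right bform_axis
          bform_commute[OF sym, of c0 "axis i 1"] algebra_simps)
    then have "s = 0 \<or> 2 * (J *v c0) $ i + s * J $ i $ i = 0"
      using iso by simp
    then show ?thesis
    proof
      assume "s = 0"
      then show ?thesis
        by (simp add: c_eq)
    next
      assume *: "2 * (J *v c0) $ i + s * J $ i $ i = 0"
      then have "J $ i $ i \<noteq> 0"
        using A(2)[OF c0(1)] by auto
      then have "s = t"
        using * by (simp add: t_def field_simps add_eq_0_iff)
      then have "c = c0 + axis i t"
        by (simp add: c_eq vec_eq_iff axis_def)
      then show ?thesis
        by simp
    qed
  qed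
  then have "?S \<subseteq> {c0, c0 + axis i t}"
    by blast
  then have "finite ?S" "card ?S \<le> card {c0, c0 + axis i t}"
    by (auto intro: finite_subset card_mono)
  moreover have "card {c0, c0 + axis i t} \<le> 2"
    by (simp add: card_insert_if)
  ultimately show ?thesis
    by simp
qed

text \<open>On \<open>E i k\<close> the chart density is at most \<open>k\<close>, fibres have at
  most two points, and the projection lies in a product of balls of radius \<open>k\<close>. The
  measure is thus at most \<open>2 * k\<close> times a finite product of finite Haar measures. The
  pieces cover the cone because \<open>J *v c\<close> is nonzero for nonzero
  \<open>c\<close>.\<close>

lemma sigma_finite_omega_X_measure:
  fixes J :: "'f::valued_field_0^'d^'d" and M :: "('f^'d) measure"
  assumes F: "local_field TYPE('f)" and haar: "haar_measure \<mu>"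
    and sym: "transpose J = J" and inv: "invertible J"
    and M: "omega_X_measure J \<mu> M"
  shows "sigma_finite_measure M"
proof
  interpret \<mu>: sigma_finite_measure \<mu>
    by (rule sigma_finite_haar_measure[OF F haar])
  interpret product_sigma_finite "\<lambda>_ :: 'd. \<mu>"
    by unfold_locales
  have space_M: "space M = cone_sm J"
    and sets_M: "sets M = sets (restrict_space borel (cone_sm J))"
    and emeasure_M: "\<And>i A. A \<in> sets M \<Longrightarrow> (\<forall>c\<in>A. (J *v c) $ i \<noteq> 0) \<Longrightarrow> emeasure M A =
         (\<integral>\<^sup>+ y. (\<Sum>c\<in>{c\<in>A. restrict (($) c) (UNIV - {i}) = y}.
              ennreal (1 / absval ((J *v c) $ i))) \<partial>Pi\<^sub>M (UNIV - {i}) (\<lambda>_. \<mu>))"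
    using M unfolding omega_X_measure_def by blast+
  \<comment> \<open>The first condition bounds the derivative below by \<open>1 / k\<close>;
    multiplied out, it is closed and makes \<open>E i 0\<close> empty.\<close>
  define E where "E i k = {c\<in>cone_sm J. 1 \<le> real k * absval ((J *v c) $ i) \<and> (\<forall>j. absval (c $ j) \<le> real k)}"
    for i and k :: nat
  have E_sets: "E i k \<in> sets M" for i k
  proof -
    let ?C = "{c. 1 \<le> real k * absval ((J *v c) $ i) \<and> (\<forall>j. absval (c $ j) \<le> real k)}"
    have "closed ?C"
      unfolding absval_def
      by (intro closed_Collect_conj closed_Collect_all closed_Collect_le continuous_intros
          continuous_on_mult_vec_nth)
    then have "cone_sm J \<inter> ?C \<in> sets M"
      unfolding sets_M sets_restrict_space by (intro imageI) (rule borel_closed)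
    also have "cone_sm J \<inter> ?C = E i k"
      by (auto simp: E_def)
    finally show ?thesis .
  qed
  have E_fin: "emeasure M (E i k) < \<infinity>" for i k
  proof -
    let ?I = "UNIV - {i}"
    let ?B = "Pi\<^sub>E ?I (\<lambda>_. cball 0 (real k))"
    let ?P = "Pi\<^sub>M ?I (\<lambda>_. \<mu>)"
    let ?S = "\<lambda>y. {c\<in>E i k. restrict (($) c) ?I = y}"
    have nz: "(J *v c) $ i \<noteq> 0" if "c \<in> E i k" for c
      using that by (auto simp: E_def)
    have cball: "cball 0 (real k) \<in> sets \<mu>" "emeasure \<mu> (cball 0 (real k)) < \<infinity>"
      using haar F unfolding haar_measure_def local_field_def by auto
    have le: "(\<Sum>c\<in>?S y. ennreal (1 / absval ((J *v c) $ i))) \<le> ennreal (2 * real k) * indicator ?B y" for y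
    proof (cases "?S y = {}")
      case True
      show ?thesis
        unfolding True by simp
    next
      case False
      then have y: "y \<in> ?B"
        by (auto simp: E_def cball_0_eq)
      have card: "card (?S y) \<le> 2"
        using card_cone_fibre_le[OF sym, of "E i k" i y] nz by (auto simp: E_def)
      have "1 / absval ((J *v c) $ i) \<le> real k" if "c \<in> ?S y" for c
        using that nz[of c] by (auto simp: E_def divide_le_eq)
      then have "(\<Sum>c\<in>?S y. ennreal (1 / absval ((J *v c) $ i))) \<le> (\<Sum>c\<in>?S y. ennreal (real k))"
        by (intro sum_mono ennreal_leI)
      also have "\<dots> = ennreal (real (card (?S y)) * real k)"
        by (simp add: ennreal_mult ennreal_of_nat_eq_real_of_nat)
      also have "\<dots> \<le> ennreal (2 * real k)"
        using card by (intro ennreal_leI mult_right_mono) auto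
      finally show ?thesis
        using y by simp
    qed
    have "emeasure M (E i k) = (\<integral>\<^sup>+ y. (\<Sum>c\<in>?S y. ennreal (1 / absval ((J *v c) $ i))) \<partial>?P)"
      using emeasure_M[OF E_sets] nz by blast
    also have "\<dots> \<le> (\<integral>\<^sup>+ y. ennreal (2 * real k) * indicator ?B y \<partial>?P)"
      by (intro nn_integral_mono le)
    also have "\<dots> = ennreal (2 * real k) * emeasure ?P ?B"
      using cball(1) by (intro nn_integral_cmult_indicator sets_PiM_I_finite) auto
    also have "emeasure ?P ?B = (\<Prod>j\<in>?I. emeasure \<mu> (cball 0 (real k)))"
      using cball(1) by (intro emeasure_PiM) auto
    also have "ennreal (2 * real k) * \<dots> < \<infinity>"
      using cball(2) by (simp add: ennreal_mult_less_top power_less_top_ennreal less_top)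
    finally show ?thesis .
  qed
  have "\<exists>i k. c \<in> E i k" if c: "c \<in> cone_sm J" for c
  proof -
    have "J *v c \<noteq> 0"
    proof
      assume "J *v c = 0"
      moreover obtain B where "B ** J = mat 1"
        using inv invertible_def by blast
      ultimately have "c = 0"
        by (metis matrix_vector_mul_assoc matrix_vector_mul_lid matrix_vector_mult_0_right)
      with c show False
        by (simp add: cone_sm_def)
    qed
    then obtain i where i: "(J *v c) $ i \<noteq> 0"
      by (auto simp: vec_eq_iff)
    define s where "s = (\<Sum>j\<in>UNIV. absval (c $ j)) + 1 / absval ((J *v c) $ i)"
    obtain k :: nat where k: "s \<le> real k"
      using real_arch_simple by blast
    have "absval (c $ j) \<le> s" for j
      unfolding s_def by (intro add_increasing2 member_le_sum) auto
    moreover have "1 / absval ((J *v c) $ i) \<le> s"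
      unfolding s_def by (simp add: sum_nonneg)
    then have "1 / absval ((J *v c) $ i) \<le> real k"
      using k by linarith
    then have "1 \<le> real k * absval ((J *v c) $ i)"
      using i by (simp add: divide_le_eq)
    ultimately have "c \<in> E i k"
      using c k unfolding E_def by (auto intro: order_trans)
    then show ?thesis
      by blast
  qed
  then have "space M \<subseteq> \<Union> (case_prod E ` UNIV)"
    unfolding space_M by (fastforce simp: image_iff)
  moreover have "\<Union> (case_prod E ` UNIV) \<subseteq> space M"
    unfolding space_M by (auto simp: E_def)
  ultimately show "\<exists>A. countable A \<and> A \<subseteq> sets M \<and> \<Union> A = space M \<and> (\<forall>a\<in>A. emeasure M a \<noteq> \<infinity>)"
    using E_sets E_fin by (intro exI[of _ "case_prod E ` UNIV"]) (auto simp: less_top)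
qed


section \<open>Weighted composition operators on \<open>L\<^sup>2\<close>\<close>

lemma square_integrable_cong_AE:
  assumes "f \<in> borel_measurable M" "square_integrable M g" "AE x in M. g x = f x"
  shows "square_integrable M f"
proof -
  have "integrable M (\<lambda>x. (norm (f x))\<^sup>2) = integrable M (\<lambda>x. (norm (g x))\<^sup>2)"
    using assms by (intro integrable_cong_AE) (auto simp: square_integrable_def)
  then show ?thesis
    using assms by (simp add: square_integrable_def)
qed

lemma L2_class_cong:
  assumes "AE x in M. f x = g x"
  shows "L2_class M f = L2_class M g"
proof -
  have "(AE x in M. h x = f x) = (AE x in M. h x = g x)" for h
    using assms by (intro iffI) (auto elim: eventually_elim2)
  then show ?thesis
    by (simp add: L2_class_def)
qed

lemma mem_L2_class_self: "square_integrable M f \<Longrightarrow> f \<in> L2_class M f"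
  by (simp add: L2_class_def)

lemma L2_class_mem_L2: "square_integrable M f \<Longrightarrow> L2_class M f \<in> L2 M"
  by (simp add: L2_def)

lemma L2_memD:
  assumes "A \<in> L2 M" "f \<in> A"
  shows "square_integrable M f" "A = L2_class M f"
proof -
  obtain g where "A = L2_class M g"
    using assms(1) by (auto simp: L2_def)
  with assms(2) show "square_integrable M f" "A = L2_class M f"
    using L2_class_cong[where M = M and f = f and g = g] by (auto simp: L2_class_def)
qed

lemma L2_nonempty: "A \<in> L2 M \<Longrightarrow> A \<noteq> {}"
  using mem_L2_class_self by (force simp: L2_def)

text \<open>\<open>L2_class M f\<close> is formed for every \<open>f\<close> and may be empty.
  Membership in \<open>L2 M\<close> provides a square integrable function almost everywhere equal to
  \<open>f\<close>.\<close>

lemma L2_class_mem_L2D: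
  assumes "f \<in> borel_measurable M" "L2_class M f \<in> L2 M"
  shows "square_integrable M f"
proof -
  obtain g where "g \<in> L2_class M f"
    using L2_nonempty[OF assms(2)] by blast
  then show ?thesis
    using square_integrable_cong_AE[OF assms(1), of g] by (simp add: L2_class_def)
qed

lemma square_integrable_indicator:
  assumes "A \<in> sets M" "emeasure M A < \<infinity>"
  shows "square_integrable M (indicator A)"
proof -
  have "(\<lambda>x. (norm (indicator A x :: complex))\<^sup>2) = (indicator A :: _ \<Rightarrow> real)"
    by (auto simp: indicator_def)
  then show ?thesis
    using assms by (simp add: square_integrable_def integrable_indicator_iff less_top Int_absorb1 sets.sets_into_space
        borel_measurable_indicator)
qed

text \<open>The general shape of \<open>parabolic_op\<close>. No choice of representative is made,
  so independence of the representative has to be proved before the union can be evaluated.\<close>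

definition L2_op :: "'a measure \<Rightarrow> ('a \<Rightarrow> complex) \<Rightarrow> ('a \<Rightarrow> 'a) \<Rightarrow>
    ('a \<Rightarrow> complex) set \<Rightarrow> ('a \<Rightarrow> complex) set"
  where "L2_op M w \<phi> = (\<lambda>A\<in>L2 M. \<Union>f\<in>A. L2_class M (\<lambda>c. w c * f (\<phi> c)))"

text \<open>Absolute continuity of the image measure of \<open>M\<close> under \<open>\<phi>\<close>
  with respect to \<open>M\<close>.\<close>

definition null_preserving :: "'a measure \<Rightarrow> ('a \<Rightarrow> 'a) \<Rightarrow> bool"
  where "null_preserving M \<phi> \<longleftrightarrow>
    \<phi> \<in> measurable M M \<and> (\<forall>Z\<in>null_sets M. \<phi> -` Z \<inter> space M \<in> null_sets M)"

lemma null_preserving_AE: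
  assumes "null_preserving M \<phi>" "AE x in M. P x"
  shows "AE x in M. P (\<phi> x)"
proof -
  obtain Z where Z: "{x \<in> space M. \<not> P x} \<subseteq> Z" "Z \<in> null_sets M"
    using assms(2) by (auto simp: eventually_ae_filter)
  have "\<phi> -` Z \<inter> space M \<in> null_sets M"
    using assms(1) Z(2) by (simp add: null_preserving_def)
  moreover have "{x \<in> space M. \<not> P (\<phi> x)} \<subseteq> \<phi> -` Z \<inter> space M"
    using assms(1) Z(1) measurable_space[of \<phi> M M] by (auto simp: null_preserving_def)
  ultimately show ?thesis
    by (rule AE_I')
qed

lemma null_preserving_comp:
  assumes "null_preserving M \<phi>1" "null_preserving M \<phi>2"
  shows "null_preserving M (\<lambda>c. \<phi>2 (\<phi>1 c))"
  unfolding null_preserving_def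
proof (intro conjI ballI)
  have m: "\<phi>1 \<in> measurable M M" "\<phi>2 \<in> measurable M M"
    using assms by (simp_all add: null_preserving_def)
  then show "(\<lambda>c. \<phi>2 (\<phi>1 c)) \<in> measurable M M"
    by measurable
  fix Z
  assume "Z \<in> null_sets M"
  then have "\<phi>2 -` Z \<inter> space M \<in> null_sets M"
    using assms(2) by (simp add: null_preserving_def)
  then have "\<phi>1 -` (\<phi>2 -` Z \<inter> space M) \<inter> space M \<in> null_sets M"
    using assms(1) unfolding null_preserving_def by blast
  also have "\<phi>1 -` (\<phi>2 -` Z \<inter> space M) \<inter> space M = (\<lambda>c. \<phi>2 (\<phi>1 c)) -` Z \<inter> space M"
    using measurable_space[OF m(1)] by auto
  finally show "(\<lambda>c. \<phi>2 (\<phi>1 c)) -` Z \<inter> space M \<in> null_sets M" .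
qed

lemma L2_op_eq_class:
  assumes "null_preserving M \<phi>" "A \<in> L2 M" "f \<in> A"
  shows "L2_op M w \<phi> A = L2_class M (\<lambda>c. w c * f (\<phi> c))"
proof -
  have eq: "L2_class M (\<lambda>c. w c * g (\<phi> c)) = L2_class M (\<lambda>c. w c * f (\<phi> c))" if "g \<in> A" for g
  proof (rule L2_class_cong)
    have "AE c in M. g c = f c"
      using L2_memD(2)[OF assms(2,3)] that by (auto simp: L2_class_def)
    then have "AE c in M. g (\<phi> c) = f (\<phi> c)"
      by (rule null_preserving_AE[OF assms(1)])
    then show "AE c in M. w c * g (\<phi> c) = w c * f (\<phi> c)"
      by eventually_elim simp
  qed
  have "(\<Union>g\<in>A. L2_class M (\<lambda>c. w c * g (\<phi> c))) = L2_class M (\<lambda>c. w c * f (\<phi> c))"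
  proof (rule SUP_eq_const)
    show "A \<noteq> {}"
      using assms(3) by blast
  qed (rule eq)
  then show ?thesis
    using assms(2) by (simp add: L2_op_def)
qed

text \<open>The last hypothesis stands in for a norm estimate: it makes the intermediate function
  \<open>h\<close> square integrable, hence a representative on which the outer operator can be
  evaluated.\<close>

lemma compose_L2_op:
  assumes "null_preserving M \<phi>1" "null_preserving M \<phi>2"
    and "w2 \<in> borel_measurable M" "L2_op M w2 \<phi>2 \<in> L2 M \<rightarrow> L2 M"
  shows "compose (L2 M) (L2_op M w1 \<phi>1) (L2_op M w2 \<phi>2) =
    L2_op M (\<lambda>c. w1 c * w2 (\<phi>1 c)) (\<lambda>c. \<phi>2 (\<phi>1 c))"
proof
  fix A
  show "compose (L2 M) (L2_op M w1 \<phi>1) (L2_op M w2 \<phi>2) A =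
    L2_op M (\<lambda>c. w1 c * w2 (\<phi>1 c)) (\<lambda>c. \<phi>2 (\<phi>1 c)) A"
  proof (cases "A \<in> L2 M")
    case True
    then obtain f where f: "f \<in> A"
      using L2_nonempty by blast
    define h where "h = (\<lambda>c. w2 c * f (\<phi>2 c))"
    have h: "L2_op M w2 \<phi>2 A = L2_class M h"
      unfolding h_def using assms(2) True f by (rule L2_op_eq_class)
    have hL2: "L2_class M h \<in> L2 M"
      using assms(4) True unfolding h[symmetric] by blast
    have "f \<in> borel_measurable M" "\<phi>2 \<in> measurable M M"
      using L2_memD(1)[OF True f] assms(2) by (simp_all add: square_integrable_def null_preserving_def)
    then have "h \<in> borel_measurable M"
      unfolding h_def using assms(3) by measurable
    then have "h \<in> L2_class M h"
      using hL2 L2_class_mem_L2D mem_L2_class_self by blast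
    then have "L2_op M w1 \<phi>1 (L2_class M h) = L2_class M (\<lambda>c. w1 c * h (\<phi>1 c))"
      by (rule L2_op_eq_class[OF assms(1) hL2])
    also have "\<dots> = L2_op M (\<lambda>c. w1 c * w2 (\<phi>1 c)) (\<lambda>c. \<phi>2 (\<phi>1 c)) A"
      using L2_op_eq_class[OF null_preserving_comp[OF assms(1,2)] True f]
      by (simp add: h_def mult.assoc)
    finally show ?thesis
      using True by (simp add: compose_def h)
  qed (simp add: compose_def L2_op_def)
qed

text \<open>Modifying the representative \<open>0\<close> on a null set \<open>Z\<close> must not change its image, which forces
  the preimage of \<open>Z\<close> to be null.\<close>

lemma null_preserving_L2_op:
  assumes "sigma_finite_measure M"
    and meas: "\<phi> \<in> measurable M M" "\<rho> \<in> measurable M M"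
    and inverse: "\<And>c. c \<in> space M \<Longrightarrow> \<rho> (\<phi> c) = c"
    and w: "w \<in> borel_measurable M" "\<And>c. c \<in> space M \<Longrightarrow> norm (w c) = k" "k > 0"
    and op: "L2_op M w \<phi> \<in> L2 M \<rightarrow> L2 M"
  shows "null_preserving M \<phi>"
proof -
  interpret sigma_finite_measure M
    by fact
  have "\<phi> -` Z \<inter> space M \<in> null_sets M" if Z: "Z \<in> null_sets M" for Z
  proof (rule ccontr)
    define Y where "Y = \<phi> -` Z \<inter> space M"
    assume "\<phi> -` Z \<inter> space M \<notin> null_sets M"
    moreover have Y: "Y \<in> sets M"
      unfolding Y_def using meas Z by (auto intro: measurable_sets)
    ultimately have pos: "emeasure M Y \<noteq> 0"
      by (auto simp: Y_def)
    \<comment> \<open>Sigma-finiteness gives a piece of finite positive measure, so that the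
      function \<open>h\<close> below is square integrable.\<close>
    obtain Y' where Y': "Y' \<in> sets M" "Y' \<subseteq> Y" "emeasure M Y' < \<infinity>" "emeasure M Y' \<noteq> 0"
    proof (cases "emeasure M Y = \<infinity>")
      case True
      obtain Z' where "Z' \<in> sets M" "Z' \<subseteq> Y" "emeasure M Z' < \<infinity>" "ennreal 1 < emeasure M Z'"
        using approx_PInf_emeasure_with_finite[OF Y True, of 1] by metis
      moreover from this have "emeasure M Z' \<noteq> 0"
        by (metis not_less_zero)
      ultimately show ?thesis
        using that by blast
    next
      case False
      then show ?thesis
        using that[of Y] Y pos by (auto simp: less_top)
    qed
    \<comment> \<open>Cutting \<open>Z\<close> down by means of \<open>\<rho>\<close> makes the
      preimage under \<open>\<phi>\<close> exactly \<open>Y'\<close> rather than all of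
      \<open>Y\<close>.\<close>
    define Z' where "Z' = Z \<inter> (\<rho> -` Y' \<inter> space M)"
    define f :: "'a \<Rightarrow> complex" where "f = indicator Z'"
    have pre: "f (\<phi> c) = indicator Y' c" if "c \<in> space M" for c
      using that Y'(2) inverse[OF that] measurable_space[OF meas(1) that]
      by (auto simp: f_def Z'_def Y_def indicator_def)
    have Z': "Z' \<in> null_sets M"
      unfolding Z'_def using Z Y'(1) meas(2) by (intro null_set_Int2) (auto intro: measurable_sets)
    have zero: "square_integrable M (\<lambda>_. 0)"
      by (simp add: square_integrable_def)
    define A where "A = L2_class M (\<lambda>_. 0)"
    have A: "A \<in> L2 M"
      unfolding A_def by (rule L2_class_mem_L2[OF zero])
    have "(\<lambda>_. 0) \<in> A"
      unfolding A_def by (rule mem_L2_class_self[OF zero])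
    have "square_integrable M f"
      unfolding f_def using Z' by (intro square_integrable_indicator) auto
    moreover have "AE c in M. f c = 0"
      using Z' by (auto simp: f_def indicator_def intro: AE_I'[of Z'])
    ultimately have "f \<in> A"
      by (simp add: A_def L2_class_def)
    define h where "h = (\<lambda>c. w c * f (\<phi> c))"
    have UA: "L2_op M w \<phi> A \<in> L2 M"
      using op A by blast
    have mem: "(\<lambda>_. 0) \<in> L2_op M w \<phi> A"
      using A \<open>(\<lambda>_. 0) \<in> A\<close> zero by (auto simp: L2_op_def L2_class_def intro!: bexI[of _ "\<lambda>_. 0"])
    \<comment> \<open>The image of the zero class contains 0 and is a class, so it is the zero
      class; yet it will also contain \<open>h\<close>.\<close>
    have UA_eq: "L2_op M w \<phi> A = A"
      by (rule L2_memD(2)[OF UA mem, folded A_def])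
    have "h \<in> borel_measurable M"
      unfolding h_def using w(1) meas(1) \<open>square_integrable M f\<close>
      by (auto simp: square_integrable_def intro!: borel_measurable_times intro: measurable_compose)
    moreover have "(norm (h c))\<^sup>2 = k\<^sup>2 * indicator Y' c" if "c \<in> space M" for c
      using that w(2) by (auto simp: h_def pre norm_mult indicator_def)
    then have "integrable M (\<lambda>c. (norm (h c))\<^sup>2) = integrable M (\<lambda>c. k\<^sup>2 * indicator Y' c :: real)"
      by (rule Bochner_Integration.integrable_cong[OF refl])
    then have "integrable M (\<lambda>c. (norm (h c))\<^sup>2)"
      using Y' by simp
    ultimately have "square_integrable M h"
      by (simp add: square_integrable_def)
    then have "h \<in> L2_op M w \<phi> A"
      using A \<open>f \<in> A\<close> mem_L2_class_self by (fastforce simp: L2_op_def h_def)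
    then have "AE c in M. h c = 0"
      unfolding UA_eq by (simp add: A_def L2_class_def)
    then have "AE c in M. c \<notin> Y'"
    proof (rule AE_mp, intro AE_I2 impI)
      fix c
      assume "c \<in> space M" "h c = 0"
      then show "c \<notin> Y'"
        using w(2)[of c] w(3) by (auto simp: h_def pre)
    qed
    then have "emeasure M Y' = 0"
      using AE_iff_null_sets[OF Y'(1)] by auto
    then show False
      using Y'(4) by simp
  qed
  then show ?thesis
    using meas(1) by (simp add: null_preserving_def)
qed

text \<open>All square integrable functions form one class, so \<open>L2 M\<close> is a point. This
  disposes of the degenerate outcome of the dilation argument.\<close>

lemma L2_null_measure:
  assumes "emeasure M (space M) = 0"
  shows "L2_op M w \<phi> \<in> Bij (L2 M)"
proof -
  have "AE x in M. P x" for P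
    using assms by (intro AE_I'[of "space M"]) auto
  then have cls: "L2_class M f = {g. square_integrable M g}" for f
    by (simp add: L2_class_def)
  have zero: "square_integrable M (\<lambda>_. 0)"
    by (simp add: square_integrable_def)
  then have "L2 M = {{g. square_integrable M g}}"
    unfolding L2_def cls by auto
  then show ?thesis
    using zero unfolding Bij_def bij_betw_def L2_op_def cls by auto
qed


section \<open>Homomorphisms into a group of operators\<close>

text \<open>Shaped for \<open>unitary_group M\<close>, which is \<open>BijGroup (L2 M)\<close> with
  a smaller carrier. The group laws are taken from the ambient group \<open>B\<close>, so the group
  structure of the unitary operators does not have to be established.\<close>

lemma image_generate_hom:
  assumes "group G" "group B" "C \<subseteq> carrier B" "T \<in> hom G (B\<lparr>carrier := C\<rparr>)" "K \<subseteq> carrier G"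
  shows "generate (B\<lparr>carrier := C\<rparr>) (T ` K) = T ` generate G K"
proof -
  interpret G: group G
    by fact
  interpret B: group B
    by fact
  let ?U = "B\<lparr>carrier := C\<rparr>"
  have closed: "T x \<in> C" if "x \<in> carrier G" for x
    using assms(4) that by (auto simp: hom_def)
  have mult: "T (x \<otimes>\<^bsub>G\<^esub> y) = T x \<otimes>\<^bsub>B\<^esub> T y" if "x \<in> carrier G" "y \<in> carrier G" for x y
    using assms(4) that by (auto simp: hom_def)
  have closed': "T x \<in> carrier B" if "x \<in> carrier G" for x
    using closed that assms(3) by blast
  have T_one: "T \<one>\<^bsub>G\<^esub> = \<one>\<^bsub>B\<^esub>"
    using mult[of "\<one>\<^bsub>G\<^esub>" "\<one>\<^bsub>G\<^esub>"] closed'[of "\<one>\<^bsub>G\<^esub>"] by simp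
  have T_inv: "inv\<^bsub>?U\<^esub> (T x) = T (inv\<^bsub>G\<^esub> x)" if x: "x \<in> carrier G" for x
    unfolding m_inv_def[of ?U]
  proof (rule the_equality)
    show "T (inv\<^bsub>G\<^esub> x) \<in> carrier ?U \<and> T x \<otimes>\<^bsub>?U\<^esub> T (inv\<^bsub>G\<^esub> x) = \<one>\<^bsub>?U\<^esub> \<and>
      T (inv\<^bsub>G\<^esub> x) \<otimes>\<^bsub>?U\<^esub> T x = \<one>\<^bsub>?U\<^esub>"
      using x closed T_one by (simp flip: mult)
    fix y
    assume "y \<in> carrier ?U \<and> T x \<otimes>\<^bsub>?U\<^esub> y = \<one>\<^bsub>?U\<^esub> \<and> y \<otimes>\<^bsub>?U\<^esub> T x = \<one>\<^bsub>?U\<^esub>"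
    then have y: "y \<in> carrier B" "y \<otimes>\<^bsub>B\<^esub> T x = \<one>\<^bsub>B\<^esub>"
      using assms(3) by auto
    moreover have "T (inv\<^bsub>G\<^esub> x) \<otimes>\<^bsub>B\<^esub> T x = \<one>\<^bsub>B\<^esub>"
      using x T_one by (simp flip: mult)
    ultimately show "y = T (inv\<^bsub>G\<^esub> x)"
      using closed' x by (metis B.inv_equality G.inv_closed)
  qed
  show ?thesis
  proof
    show "generate ?U (T ` K) \<subseteq> T ` generate G K"
    proof
      fix u
      assume "u \<in> generate ?U (T ` K)"
      then show "u \<in> T ` generate G K"
      proof induction
        case one
        then show ?case
          using T_one generate.one[of G K] by (auto intro: image_eqI[OF sym])
      next
        case (incl h)
        then obtain x where "x \<in> K" "h = T x"
          by blast
        then show ?case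
          by (simp add: generate.incl)
      next
        case (inv h)
        then obtain x where "x \<in> K" "h = T x"
          by blast
        then have "inv\<^bsub>?U\<^esub> h = T (inv\<^bsub>G\<^esub> x)"
          using T_inv assms(5) by blast
        then show ?case
          using \<open>x \<in> K\<close> by (simp add: generate.inv)
      next
        case (eng h1 h2)
        then obtain x y where "x \<in> generate G K" "y \<in> generate G K" "h1 = T x" "h2 = T y"
          by blast
        then have "h1 \<otimes>\<^bsub>?U\<^esub> h2 = T (x \<otimes>\<^bsub>G\<^esub> y)"
          using G.generate_in_carrier[OF assms(5)] by (simp add: mult)
        then show ?case
          using \<open>x \<in> generate G K\<close> \<open>y \<in> generate G K\<close> by (simp add: generate.eng)
      qed
    qed
    show "T ` generate G K \<subseteq> generate ?U (T ` K)"
    proof (rule image_subsetI)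
      fix x
      assume "x \<in> generate G K"
      then show "T x \<in> generate ?U (T ` K)"
      proof induction
        case one
        then show ?case
          using generate.one[of ?U "T ` K"] T_one by simp
      next
        case (incl h)
        then show ?case
          by (intro generate.incl imageI)
      next
        case (inv h)
        then have "T (inv\<^bsub>G\<^esub> h) = inv\<^bsub>?U\<^esub> (T h)"
          using T_inv assms(5) by auto
        then show ?case
          using inv generate.inv[of "T h" "T ` K" ?U] by simp
      next
        case (eng h1 h2)
        then have "T (h1 \<otimes>\<^bsub>G\<^esub> h2) = T h1 \<otimes>\<^bsub>?U\<^esub> T h2"
          using G.generate_in_carrier[OF assms(5)] by (simp add: mult)
        then show ?case
          using eng generate.eng[of "T h1" ?U "T ` K" "T h2"] by simp
      qed
    qed
  qed
qed


section \<open>The parabolic operators\<close>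

lemma mult_unitary_group [simp]: "x \<otimes>\<^bsub>unitary_group M\<^esub> y = x \<otimes>\<^bsub>BijGroup (L2 M)\<^esub> y"
  by (simp add: unitary_group_def)

lemma carrier_unitary_group_subset: "carrier (unitary_group M) \<subseteq> Bij (L2 M)"
  by (auto simp: unitary_group_def)

lemma mult_BijGroup: "x \<in> Bij S \<Longrightarrow> y \<in> Bij S \<Longrightarrow> x \<otimes>\<^bsub>BijGroup S\<^esub> y = compose S x y"
  by (simp add: BijGroup_def)

lemma carrier_BijGroup [simp]: "carrier (BijGroup S) = Bij S"
  by (simp add: BijGroup_def)

context
  fixes J :: "'f::valued_field_0^'d^'d"
    and \<psi> :: "'f \<Rightarrow> complex"
    and \<mu> :: "'f measure"
    and M :: "('f^'d) measure"
  assumes F: "local_field TYPE('f)"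
    and \<psi>: "nontrivial_additive_character \<psi>"
    and J_sym: "transpose J = J" and J_inv: "invertible J"
    and haar: "haar_measure \<mu>"
    and M: "omega_X_measure J \<mu> M"
begin

lemma character_0: "\<psi> 0 = 1"
proof -
  have "\<psi> 0 * \<psi> 0 = \<psi> 0" "\<psi> 0 \<noteq> 0"
    using \<psi> unfolding nontrivial_additive_character_def by (metis add_0, metis norm_zero zero_neq_one)
  then show ?thesis
    by simp
qed

lemma space_cone_measure: "space M = cone_sm J"
  and sets_cone_measure: "sets M = sets (restrict_space borel (cone_sm J))"
  using M by (simp_all add: omega_X_measure_def)

lemma sigma_finite_cone_measure: "sigma_finite_measure M"
  by (rule sigma_finite_omega_X_measure[OF F haar J_sym J_inv M])

lemma measurable_on_cone:
  assumes "f \<in> borel_measurable borel"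
  shows "f \<in> borel_measurable M"
  unfolding measurable_cong_sets[OF sets_cone_measure refl]
  using assms by (rule measurable_restrict_space1)

lemma similitude_maps_cone:
  assumes "a \<noteq> 0" "g \<in> carrier (orth_sim_group J)" "c \<in> cone_sm J"
  shows "a *s (c v* g) \<in> cone_sm J"
proof -
  have "qform J (a *s (c v* g)) = 0"
    using assms(3)
    by (simp add: cone_sm_def qform_def bform_scale_left bform_scale_right
        bform_sim_norm[OF J_inv assms(2)])
  moreover have "c v* g \<noteq> 0"
  proof
    assume "c v* g = 0"
    moreover obtain h where "g ** h = mat 1"
      using assms(2) by (auto simp: orth_sim_group_def invertible_def)
    ultimately have "c = 0"
      by (metis vector_matrix_mul_assoc vector_matrix_mul_rid vector_matrix_mult_0)
    with assms(3) show False
      by (simp add: cone_sm_def)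
  qed
  ultimately show ?thesis
    using assms(1) by (simp add: cone_sm_def)
qed

lemma similitude_measurable:
  assumes "a \<noteq> 0" "g \<in> carrier (orth_sim_group J)"
  shows "(\<lambda>c. a *s (c v* g)) \<in> measurable M M"
  unfolding measurable_cong_sets[OF sets_cone_measure sets_cone_measure]
proof (rule measurable_restrict_space2)
  show "(\<lambda>c. a *s (c v* g)) \<in> borel_measurable (restrict_space borel (cone_sm J))"
    by (intro measurable_restrict_space1 borel_measurable_continuous_onI continuous_on_scale_mult_vec)
  show "(\<lambda>c. a *s (c v* g)) \<in> space (restrict_space borel (cone_sm J)) \<rightarrow> cone_sm J"
    using similitude_maps_cone[OF assms] by (simp add: space_restrict_space)
qed

definition weight :: "'f^'d \<Rightarrow> 'f \<Rightarrow> 'f^'d^'d \<Rightarrow> 'f^'d \<Rightarrow> complex"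
  where "weight v a g c = \<psi> (bform J v c)
      * of_real (absval a powr ((real CARD('d) - 2) / 2))
      * of_real (absval (sim_norm J g) powr ((real CARD('d) - 2) / 4))"

abbreviation P where "P \<equiv> parabolic_op \<psi> J M"

lemma parabolic_op_eq: "P v a g = L2_op M (weight v a g) (\<lambda>c. a *s (c v* g))"
  by (simp add: parabolic_op_def L2_op_def weight_def)

lemma weight_measurable: "weight v a g \<in> borel_measurable M"
proof (rule measurable_on_cone)
  have "continuous_on UNIV (\<lambda>c. \<psi> (bform J v c))"
    using \<psi> continuous_on_bform_right unfolding nontrivial_additive_character_def
    by (metis continuous_on_compose2 subset_UNIV)
  then have "(\<lambda>c. \<psi> (bform J v c)) \<in> borel_measurable borel"
    by (rule borel_measurable_continuous_onI)
  then show "weight v a g \<in> borel_measurable borel"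
    unfolding weight_def by (intro borel_measurable_times borel_measurable_const)
qed

lemma norm_weight:
  "norm (weight v a g c) = absval a powr ((real CARD('d) - 2) / 2)
      * absval (sim_norm J g) powr ((real CARD('d) - 2) / 4)"
  using \<psi> by (simp add: weight_def nontrivial_additive_character_def norm_mult)

text \<open>The modulus of the weight is a positive constant, and the substitution has the
  measurable inverse given by \<open>inverse a\<close> and the inverse matrix \<open>h\<close>.
  These are the inputs that turn the mapping property of the operator into quasi-invariance.\<close>

lemma null_preserving_similitude:
  assumes "a \<noteq> 0" "g \<in> carrier (orth_sim_group J)" "P v a g \<in> L2 M \<rightarrow> L2 M"
  shows "null_preserving M (\<lambda>c. a *s (c v* g))"
proof -
  interpret group "orth_sim_group J"
    by (rule group_orth_sim_group[OF J_inv])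
  obtain h where h: "h \<in> carrier (orth_sim_group J)" "g ** h = mat 1"
    using r_inv_ex[OF assms(2)] by (auto simp: orth_sim_group_def)
  show ?thesis
  proof (rule null_preserving_L2_op[OF sigma_finite_cone_measure])
    show "(\<lambda>c. a *s (c v* g)) \<in> measurable M M"
      by (rule similitude_measurable[OF assms(1,2)])
    show "(\<lambda>c. inverse a *s (c v* h)) \<in> measurable M M"
      using assms(1) h(1) by (intro similitude_measurable) auto
    show "inverse a *s ((a *s (c v* g)) v* h) = c" for c
      using assms(1) by (simp add: scalar_vector_matrix_assoc vector_matrix_mul_assoc h(2))
    show "weight v a g \<in> borel_measurable M"
      by (rule weight_measurable)
    show "norm (weight v a g c) = absval a powr ((real CARD('d) - 2) / 2)
      * absval (sim_norm J g) powr ((real CARD('d) - 2) / 4)" for c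
      by (rule norm_weight)
    show "0 < absval a powr ((real CARD('d) - 2) / 2)
      * absval (sim_norm J g) powr ((real CARD('d) - 2) / 4)"
      using assms(1) sim_norm_nonzero[OF J_inv assms(2)] by simp
    show "L2_op M (weight v a g) (\<lambda>c. a *s (c v* g)) \<in> L2 M \<rightarrow> L2 M"
      using assms(3) by (simp add: parabolic_op_eq)
  qed
qed

text \<open>The left factor has trivial matrix part and the right one trivial character, so no
  character has to be transported through the substitution. The uses are undoing a dilation and
  attaching the character of \<open>n_mat J v\<close>.\<close>

lemma compose_parabolic_op:
  assumes "a \<noteq> 0" "b \<noteq> 0" "g \<in> carrier (orth_sim_group J)"
    and "P v a (mat 1) \<in> L2 M \<rightarrow> L2 M" "P 0 b g \<in> L2 M \<rightarrow> L2 M"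
  shows "compose (L2 M) (P v a (mat 1)) (P 0 b g) = P v (a * b) g"
proof -
  have "compose (L2 M) (P v a (mat 1)) (P 0 b g) =
      L2_op M (\<lambda>c. weight v a (mat 1) c * weight 0 b g (a *s (c v* mat 1)))
        (\<lambda>c. b *s ((a *s (c v* mat 1)) v* g))"
    unfolding parabolic_op_eq
    using null_preserving_similitude[OF assms(1) mat_1_mem_sim[OF J_inv] assms(4)]
      null_preserving_similitude[OF assms(2,3,5)] assms(5)
    by (intro compose_L2_op weight_measurable) (simp_all add: parabolic_op_eq)
  also have "(\<lambda>c. weight v a (mat 1) c * weight 0 b g (a *s (c v* mat 1))) = weight v (a * b) g"
    by (simp add: fun_eq_iff weight_def character_0 J_inv absval_mult powr_mult)
  also have "(\<lambda>c. b *s ((a *s (c v* mat 1)) v* g)) = (\<lambda>c. (a * b) *s (c v* g))"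
    by (simp add: fun_eq_iff scalar_vector_matrix_assoc mult.commute)
  finally show ?thesis
    by (simp add: parabolic_op_eq)
qed

text \<open>A dilation moves each shell \<open>\<bar>b\<bar>\<^sup>k \<le> \<parallel>c\<parallel> < \<bar>b\<bar>\<^sup>k\<^sup>+\<^sup>1\<close> off itself, so it can only act
  trivially if all shells are null.\<close>

lemma null_measure_if_dilation_trivial:
  assumes b: "absval b > 1" and triv: "P 0 b (mat 1) = (\<lambda>A\<in>L2 M. A)"
  shows "emeasure M (space M) = 0"
proof -
  interpret sigma_finite_measure M
    by (rule sigma_finite_cone_measure)
  have b0: "b \<noteq> 0"
    using b by auto
  define N :: "'f^'d \<Rightarrow> real" where "N c = (\<Sum>j\<in>UNIV. absval (c $ j))" for c
  define S where "S k = {c \<in> space M. absval b powi k \<le> N c \<and> N c < absval b powi (k + 1)}" for k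
  have N_scale: "N (b *s c) = absval b * N c" for c
    by (simp add: N_def absval_mult sum_distrib_left)
  have "continuous_on UNIV N"
    unfolding N_def absval_def by (intro continuous_intros)
  then have N_meas: "N \<in> borel_measurable M"
    by (intro measurable_on_cone borel_measurable_continuous_onI)
  have S: "S k \<in> sets M" for k
    unfolding S_def using N_meas by measurable
  \<comment> \<open>Acting trivially includes mapping \<open>L2 M\<close> to itself, which is all
    that quasi-invariance requires.\<close>
  have null: "null_preserving M (\<lambda>c. b *s (c v* mat 1))"
    using b0 by (intro null_preserving_similitude[where v = 0] mat_1_mem_sim J_inv) (simp_all add: triv)
  have S_null: "S k \<in> null_sets M" for k
  proof (rule ccontr)
    assume "S k \<notin> null_sets M"
    then have pos: "emeasure M (S k) \<noteq> 0"
      using S by auto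
    obtain A where A: "A \<in> sets M" "A \<subseteq> S k" "emeasure M A < \<infinity>" "emeasure M A \<noteq> 0"
    proof (cases "emeasure M (S k) = \<infinity>")
      case True
      obtain A where "A \<in> sets M" "A \<subseteq> S k" "emeasure M A < \<infinity>" "ennreal 1 < emeasure M A"
        using approx_PInf_emeasure_with_finite[OF S True, of 1] by metis
      moreover from this have "emeasure M A \<noteq> 0"
        by (metis not_less_zero)
      ultimately show ?thesis
        using that by blast
    next
      case False
      then show ?thesis
        using that[of "S k"] S pos by (auto simp: less_top)
    qed
    let ?f = "indicator A :: _ \<Rightarrow> complex"
    have f: "square_integrable M ?f"
      using A by (intro square_integrable_indicator)
    have "L2_class M ?f = P 0 b (mat 1) (L2_class M ?f)"
      by (simp add: triv L2_class_mem_L2[OF f])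
    also have "\<dots> = L2_class M (\<lambda>c. weight 0 b (mat 1) c * ?f (b *s (c v* mat 1)))"
      unfolding parabolic_op_eq
      by (rule L2_op_eq_class[OF null L2_class_mem_L2[OF f] mem_L2_class_self[OF f]])
    finally have "?f \<in> L2_class M (\<lambda>c. weight 0 b (mat 1) c * ?f (b *s (c v* mat 1)))"
      using mem_L2_class_self[OF f] by simp
    then have "AE c in M. ?f c = weight 0 b (mat 1) c * ?f (b *s (c v* mat 1))"
      by (simp add: L2_class_def)
    then have "AE c in M. c \<notin> A"
    proof (rule AE_mp, intro AE_I2 impI notI)
      fix c
      assume c: "?f c = weight 0 b (mat 1) c * ?f (b *s (c v* mat 1))" "c \<in> A"
      have "b *s c \<in> A"
        by (rule ccontr) (use c in simp)
      then have "N (b *s c) < absval b powi (k + 1)"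
        using A(2) by (auto simp: S_def)
      moreover have "absval b * absval b powi k \<le> absval b * N c"
        using A(2) c(2) by (intro mult_left_mono) (auto simp: S_def)
      ultimately show False
        using b0 by (simp add: N_scale power_int_add mult.commute)
    qed
    then show False
      using AE_iff_null_sets[OF A(1)] A(4) by auto
  qed
  have "space M \<subseteq> (\<Union>k. S k)"
  proof
    fix c
    assume c: "c \<in> space M"
    then obtain j where "c $ j \<noteq> 0"
      by (auto simp: space_cone_measure cone_sm_def vec_eq_iff)
    then have pos: "N c > 0"
      unfolding N_def by (intro sum_pos2[of _ j]) auto
    define k where "k = \<lfloor>log (absval b) (N c)\<rfloor>"
    have "absval b powr k \<le> N c" "N c < absval b powr (k + 1)"
      using b pos by (simp_all add: k_def flip: le_log_iff log_less_iff)
    then have "c \<in> S k"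
      using b0 c by (simp add: S_def powr_real_of_int' flip: of_int_add)
    then show "c \<in> (\<Union>k. S k)"
      by blast
  qed
  then have "space M = (\<Union>k. S k)"
    by (auto simp: S_def)
  moreover have "(\<Union>k. S k) \<in> null_sets M"
    using S_null by (intro null_sets_UN') auto
  ultimately show ?thesis
    by auto
qed

end


section \<open>The image of the minimal representation\<close>

context
  fixes J :: "'f::valued_field_0^'d^'d"
    and \<psi> :: "'f \<Rightarrow> complex"
    and \<mu> :: "'f measure"
    and M :: "('f^'d) measure"
    and \<tau> T :: "'f^('d plus_index)^('d plus_index) \<Rightarrow>
      ('f^'d \<Rightarrow> complex) set \<Rightarrow> ('f^'d \<Rightarrow> complex) set"
  assumes F: "local_field TYPE('f)"
    and \<psi>: "nontrivial_additive_character \<psi>"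
    and J_sym: "transpose J = J" and J_inv: "invertible J"
    and haar: "haar_measure \<mu>"
    and M: "omega_X_measure J \<mu> M"
    and \<tau>: "minimal_rep_orth \<psi> J M \<tau>"
    and T: "minimal_rep_sim \<psi> J M \<tau> T"
begin

abbreviation "O_plus \<equiv> carrier (orth_group (gram_plus J))"
abbreviation "GO_plus \<equiv> carrier (orth_sim_group (gram_plus J))"
abbreviation "Pop \<equiv> parabolic_op \<psi> J M"
abbreviation "BL \<equiv> BijGroup (L2 M)"

interpretation BL: group BL
  by (rule group_BijGroup)

lemma orth_rep_hom: "\<tau> \<in> hom (orth_group (gram_plus J)) (unitary_group M)"
  using \<tau> by (simp add: minimal_rep_orth_def unitary_rep_def)

lemma orth_rep_Bij: "h \<in> O_plus \<Longrightarrow> \<tau> h \<in> Bij (L2 M)"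
  by (rule subsetD[OF carrier_unitary_group_subset hom_in_carrier[OF orth_rep_hom]])

lemma orth_rep_mult: "g \<in> O_plus \<Longrightarrow> h \<in> O_plus \<Longrightarrow> \<tau> (g ** h) = \<tau> g \<otimes>\<^bsub>BL\<^esub> \<tau> h"
  using hom_mult[OF orth_rep_hom, of g h] by (simp add: orth_group_def)

lemma orth_rep_parabolic:
  "a \<noteq> 0 \<Longrightarrow> g \<in> carrier (orth_group J) \<Longrightarrow> \<tau> (n_mat J v ** m_mat J a g) = Pop v a g"
  using \<tau> by (simp add: minimal_rep_orth_def)

lemma sim_rep_hom: "T \<in> hom (orth_sim_group (gram_plus J)) (unitary_group M)"
  using T by (simp add: minimal_rep_sim_def unitary_rep_def)

lemma sim_rep_Bij: "h \<in> GO_plus \<Longrightarrow> T h \<in> Bij (L2 M)"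
  by (rule subsetD[OF carrier_unitary_group_subset hom_in_carrier[OF sim_rep_hom]])

lemma sim_rep_mult: "g \<in> GO_plus \<Longrightarrow> h \<in> GO_plus \<Longrightarrow> T (g ** h) = T g \<otimes>\<^bsub>BL\<^esub> T h"
  using hom_mult[OF sim_rep_hom, of g h] by (simp add: orth_sim_group_def)

lemma sim_rep_extends:
  assumes "a \<noteq> 0" "g \<in> carrier (orth_sim_group J)" "h \<in> O_plus"
  shows "T (m_mat J a g ** h) = Pop 0 a g \<otimes>\<^bsub>BL\<^esub> \<tau> h"
  using T assms by (simp add: minimal_rep_sim_def)

lemma mat_1_mem_O_plus: "mat 1 \<in> O_plus"
  by (rule mat_1_mem_orth) (rule invertible_gram_plus[OF J_inv])

lemma orth_rep_one: "\<tau> (mat 1) = \<one>\<^bsub>BL\<^esub>"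
  using orth_rep_mult[OF mat_1_mem_O_plus mat_1_mem_O_plus] orth_rep_Bij[OF mat_1_mem_O_plus]
  by simp

text \<open>Read off from \<open>\<tau>\<close> at the identity matrix instead of computed on
  functions.\<close>

lemma parabolic_op_one: "Pop 0 1 (mat 1) = \<one>\<^bsub>BL\<^esub>"
  using orth_rep_parabolic[of 1 "mat 1" 0] mat_1_mem_orth[OF J_inv] orth_rep_one
  by (simp add: n_mat_zero[OF J_sym J_inv] m_mat_one[OF J_sym J_inv])

lemma sim_rep_orth: "h \<in> O_plus \<Longrightarrow> T h = \<tau> h"
  using sim_rep_extends[of 1 "mat 1" h] mat_1_mem_sim[OF J_inv] orth_rep_Bij
  by (simp add: m_mat_one[OF J_sym J_inv] parabolic_op_one)

text \<open>\<open>n_mat J v ** m_mat J a (mat 1)\<close> is an isometry, so these operators are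
  values of \<open>\<tau>\<close>. This is the supply of bijective operators from which the proper
  similitudes are handled.\<close>

lemma parabolic_op_orth_Bij:
  assumes "a \<noteq> 0"
  shows "Pop v a (mat 1) \<in> Bij (L2 M)" and "\<tau> (n_mat J v ** m_mat J a (mat 1)) = Pop v a (mat 1)"
    and "n_mat J v ** m_mat J a (mat 1) \<in> O_plus"
proof -
  show "n_mat J v ** m_mat J a (mat 1) \<in> O_plus"
    unfolding mem_orth_group_iff[OF invertible_gram_plus[OF J_inv]]
    using assms n_mat_orth[OF J_sym J_inv, of v]
    unfolding mem_orth_group_iff[OF invertible_gram_plus[OF J_inv]]
    by (simp add: mult_m_mat bform_gram_plus J_inv flip: vector_matrix_mul_assoc)
  moreover show "\<tau> (n_mat J v ** m_mat J a (mat 1)) = Pop v a (mat 1)"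
    using assms mat_1_mem_orth[OF J_inv] by (rule orth_rep_parabolic)
  ultimately show "Pop v a (mat 1) \<in> Bij (L2 M)"
    using orth_rep_Bij by metis
qed

text \<open>Multiplication in \<^const>\<open>BijGroup\<close> is undefined outside the carrier, so the hypothesis on
  \<open>T\<close> says nothing where \<open>Pop 0 a g\<close> fails to be bijective. On the set of such \<open>(a, g)\<close>, however,
  \<open>T (m_mat J a g)\<close> is constant; hence if the set contained both \<open>(a, g)\<close> and \<open>(b a, g)\<close>, the
  dilation by \<open>b\<close> would act trivially.\<close>

lemma parabolic_op_Bij:
  assumes a: "a \<noteq> 0" and g: "g \<in> carrier (orth_sim_group J)"
  shows "Pop 0 a g \<in> Bij (L2 M)"
proof (rule ccontr)
  assume not_Bij: "Pop 0 a g \<notin> Bij (L2 M)"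
  obtain b :: 'f where b: "absval b > 1"
    using F by (auto simp: local_field_def)
  have b0: "b \<noteq> 0"
    using b by auto
  have T_m: "T (m_mat J c g) = Pop 0 c g \<otimes>\<^bsub>BL\<^esub> \<one>\<^bsub>BL\<^esub>" if "c \<noteq> 0" for c
    using sim_rep_extends[OF that g mat_1_mem_O_plus] by (simp add: orth_rep_one)
  have junk: "U \<otimes>\<^bsub>BL\<^esub> \<one>\<^bsub>BL\<^esub> = undefined \<one>\<^bsub>BL\<^esub>" if "U \<notin> Bij (L2 M)" for U
    using that by (simp add: BijGroup_def)
  show False
  proof (cases "Pop 0 (b * a) g \<in> Bij (L2 M)")
    case True
    \<comment> \<open>Following the bijective operator at \<open>(b * a, g)\<close> by the inverse
      dilation would make the one at \<open>(a, g)\<close> bijective.\<close>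
    have "Pop 0 (inverse b) (mat 1) \<in> Bij (L2 M)"
      using b0 by (intro parabolic_op_orth_Bij) simp
    then have "compose (L2 M) (Pop 0 (inverse b) (mat 1)) (Pop 0 (b * a) g) \<in> Bij (L2 M)"
      using True by (rule compose_Bij)
    moreover have "compose (L2 M) (Pop 0 (inverse b) (mat 1)) (Pop 0 (b * a) g) =
        Pop 0 (inverse b * (b * a)) g"
      using a b0 g True \<open>Pop 0 (inverse b) (mat 1) \<in> Bij (L2 M)\<close>
      by (intro compose_parabolic_op[OF F \<psi> J_sym J_inv haar M]) (simp_all add: Bij_imp_funcset)
    ultimately show False
      using not_Bij b0 by (simp flip: mult.assoc)
  next
    case False
    have m: "m_mat J c h \<in> GO_plus" if "c \<noteq> 0" "h \<in> carrier (orth_sim_group J)" for c h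
      using that by (rule m_mat_sim[OF J_sym J_inv])
    have "T (m_mat J b (mat 1)) \<otimes>\<^bsub>BL\<^esub> T (m_mat J a g) = T (m_mat J (b * a) g)"
      using sim_rep_mult[OF m[OF b0 mat_1_mem_sim[OF J_inv]] m[OF a g]]
      by (simp add: m_mat_mult[OF J_sym J_inv b0 a])
    also have "\<dots> = T (m_mat J a g)"
      using a b0 not_Bij False by (simp add: T_m junk)
    finally have "T (m_mat J b (mat 1)) = \<one>\<^bsub>BL\<^esub>"
      using sim_rep_Bij m[OF b0 mat_1_mem_sim[OF J_inv]] m[OF a g]
      by (metis BL.r_cancel_one carrier_BijGroup)
    moreover have "T (m_mat J b (mat 1)) = Pop 0 b (mat 1)"
      using parabolic_op_orth_Bij(2,3)[OF b0, of 0] sim_rep_orth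
      by (simp add: n_mat_zero[OF J_sym J_inv])
    ultimately have "Pop 0 b (mat 1) = (\<lambda>A\<in>L2 M. A)"
      by (simp add: BijGroup_def)
    \<comment> \<open>A null cone is not refuted; it makes the operator bijective for the trivial
      reason, which is contradiction enough.\<close>
    then have "emeasure M (space M) = 0"
      by (rule null_measure_if_dilation_trivial[OF F \<psi> J_sym J_inv haar M b])
    then have "Pop 0 a g \<in> Bij (L2 M)"
      unfolding parabolic_op_eq[OF F \<psi> J_sym J_inv haar M] by (rule L2_null_measure)
    then show False
      using not_Bij by simp
  qed
qed

text \<open>With bijectivity in hand, multiplication in \<open>BijGroup\<close> is honest
  composition, and the two factors are known separately: the unipotent one through
  \<open>\<tau>\<close>, the Levi one through the extension hypothesis.\<close>

lemma sim_rep_parabolic: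
  assumes a: "a \<noteq> 0" and g: "g \<in> carrier (orth_sim_group J)"
  shows "T (n_mat J v ** m_mat J a g) = Pop v a g"
proof -
  have n: "n_mat J v \<in> O_plus"
    by (rule n_mat_orth[OF J_sym J_inv])
  have "T (n_mat J v) = Pop v 1 (mat 1)"
    using parabolic_op_orth_Bij(2)[of 1 v] n sim_rep_orth by (simp add: m_mat_one[OF J_sym J_inv])
  moreover have "T (m_mat J a g) = Pop 0 a g"
    using sim_rep_extends[OF a g mat_1_mem_O_plus] parabolic_op_Bij[OF a g]
    by (simp add: orth_rep_one)
  ultimately have "T (n_mat J v ** m_mat J a g) = Pop v 1 (mat 1) \<otimes>\<^bsub>BL\<^esub> Pop 0 a g"
    using sim_rep_mult[OF orth_group_subset_sim[THEN subsetD, OF n] m_mat_sim[OF J_sym J_inv a g]]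
    by simp
  also have "\<dots> = compose (L2 M) (Pop v 1 (mat 1)) (Pop 0 a g)"
    using parabolic_op_orth_Bij(1) parabolic_op_Bij[OF a g] by (simp add: mult_BijGroup)
  also have "\<dots> = Pop v (1 * a) g"
    using a g parabolic_op_orth_Bij(1)[of 1 v] parabolic_op_Bij[OF a g]
    by (intro compose_parabolic_op[OF F \<psi> J_sym J_inv haar M]) (simp_all add: Bij_imp_funcset)
  finally show ?thesis
    by simp
qed

lemma modulation_group_eq_image: "modulation_group \<psi> J M T = T ` GO_plus"
proof -
  let ?K = "insert w0_mat (parabolic_generators J)"
  have "T ` parabolic_generators J =
      {T (n_mat J v ** m_mat J a g) |v a g. a \<noteq> 0 \<and> g \<in> carrier (orth_sim_group J)}"
    unfolding parabolic_generators_def[OF J_sym J_inv] by blast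
  also have "\<dots> = {Pop v a g |v a g. a \<noteq> 0 \<and> g \<in> carrier (orth_sim_group J)}"
    by (intro Collect_cong ex_cong1) (auto simp: sim_rep_parabolic)
  finally have "T ` parabolic_generators J =
      {Pop v a g |v a g. a \<noteq> 0 \<and> g \<in> carrier (orth_sim_group J)}" .
  then have "modulation_group \<psi> J M T = generate (unitary_group M) (T ` ?K)"
    by (simp add: modulation_group_def)
  also have "\<dots> = T ` generate (orth_sim_group (gram_plus J)) ?K"
  proof -
    have "group (orth_sim_group (gram_plus J))"
      by (intro group_orth_sim_group invertible_gram_plus J_inv)
    moreover have "?K \<subseteq> GO_plus"
      by (rule parabolic_generators_subset[OF J_sym J_inv])
    moreover have U: "BL\<lparr>carrier := carrier (unitary_group M)\<rparr> = unitary_group M"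
      by (simp add: unitary_group_def)
    ultimately show ?thesis
      using image_generate_hom[of "orth_sim_group (gram_plus J)" BL "carrier (unitary_group M)" T ?K,
          unfolded U, OF _ group_BijGroup _ sim_rep_hom] carrier_unitary_group_subset[of M]
      by simp
  qed
  also have "generate (orth_sim_group (gram_plus J)) ?K = GO_plus"
    by (rule orth_sim_group_generated[OF J_sym J_inv])
  finally show ?thesis .
qed

end

theorem theorem1p3:
  fixes J :: "'f::valued_field_0^'d^'d"
    and \<psi> :: "'f \<Rightarrow> complex"
    and \<mu> :: "'f measure"
    and M :: "('f^'d) measure"
    and \<tau> \<tau>' :: "'f^('d plus_index)^('d plus_index) \<Rightarrow>
      ('f^'d \<Rightarrow> complex) set \<Rightarrow> ('f^'d \<Rightarrow> complex) set"
    and n :: nat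
  assumes "nonarchimedean_local_field TYPE('f) \<and> 2 * n \<ge> 6 \<or> is_real_field TYPE('f)"
    and "nontrivial_additive_character \<psi>"
    and "split_quadratic_space n J"
    and "haar_measure \<mu>"
    and "omega_X_measure J \<mu> M"
    and "minimal_rep_orth \<psi> J M \<tau>"
    and "minimal_rep_sim \<psi> J M \<tau> \<tau>'"
  shows "modulation_group \<psi> J M \<tau>' = \<tau>' ` carrier (orth_sim_group (gram_plus J))"
proof -
  have "local_field TYPE('f)"
    using assms(1) nonarchimedean_imp_local_field real_field_imp_local_field by blast
  moreover have "transpose J = J" "invertible J"
    using assms(3) by (simp_all add: split_quadratic_space_def)
  ultimately show ?thesis
    using assms(2,4-7) modulation_group_eq_image by blast
qed

end
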